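(* Let $\widetilde a:\mathbb H^2\to\mathbb C$ have an absolutely convergent Dirichlet series, $\widetilde a(s_1,s_2)=\sum_{(m,n)\in\mathbb N^2}a(m,n)m^{-s_1}n^{-s_2}$ for all $(s_1,s_2)\in\mathbb H^2$, with $\sum_{(m,n)\in\mathbb N^2}|a(m,n)|<\infty$. Then the following are equivalent: (i) $1/\widetilde a$ has an absolutely convergent Dirichlet series; (ii) the coefficient function $a=(a(m,n))$ is invertible in the Banach algebra $\ell^1(\mathbb N^2)$; (iii) $\widetilde a$ is bounded away from zero on $\mathbb H^2$.
   Context: $\mathbb N=\{1,2,\dots\}$, $\mathbb H=\{z\in\mathbb C:\operatorname{Re}z\ge 0\}$ is the closed right half plane. $\mathbb N^2$ is a semigroup under coordinatewise multiplication $(m_1,n_1)(m_2,n_2)=(m_1m_2,n_1n_2)$. A function $\widetilde a:\mathbb H^2\to\mathbb C$ has an absolutely convergent Dirichlet series if there is $a:\mathbb N^2\to\mathbb C$ with $\sum_{(m,n)}|a(m,n)|<\infty$ and $\widetilde a(s_1,s_2)=\sum_{(m,n)\in\mathbb N^2}a(m,n)m^{-s_1}n^{-s_2}$ for all $(s_1,s_2)\in\mathbb H^2$. $\ell^1(\mathbb N^2)=\{a:\mathbb N^2\to\mathbb C:\sum|a(m,n)|<\infty\}$ is a unital commutative Banach algebra with norm $\sum|a(m,n)|$ and convolution $(a\star b)(m,n)=\sum_{u_1u_2=m,\ v_1v_2=n}a(u_1,v_1)b(u_2,v_2)$. $\widetilde a$ is bounded away from zero if there is $k>0$ with $|\widetilde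 a(s_1,s_2)|\ge k$ for all $(s_1,s_2)\in\mathbb H^2$. *)

theory Defs
  imports "HOL-Analysis.Analysis"
begin

definition N2 :: "(nat \<times> nat) set" where
  "N2 = {(m, n). 1 \<le> m \<and> 1 \<le> n}"

definition HH :: "complex set" where
  "HH = {z. 0 \<le> Re z}"

text \<open>Membership in l^1(N^2): absolutely summable coefficients (only values on N2 matter).\<close>
definition l1 :: "(nat \<times> nat \<Rightarrow> complex) set" where
  "l1 = {a. (\<lambda>k. norm (a k)) summable_on N2}"

definition dconv :: "(nat \<times> nat \<Rightarrow> complex) \<Rightarrow> (nat \<times> nat \<Rightarrow> complex) \<Rightarrow> nat \<times> nat \<Rightarrow> complex" where
  "dconv a b = (\<lambda>(m, n). \<Sum>u1 | u1 dvd m. \<Sum>v1 | v1 dvd n. a (u1, v1) * b (m div u1, n div v1))"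

definition dunit :: "nat \<times> nat \<Rightarrow> complex" where
  "dunit = (\<lambda>k. if k = (1, 1) then 1 else 0)"

definition l1_invertible :: "(nat \<times> nat \<Rightarrow> complex) \<Rightarrow> bool" where
  "l1_invertible a \<longleftrightarrow> a \<in> l1 \<and> (\<exists>b \<in> l1. (\<forall>k\<in>N2. dconv a b k = dunit k) \<and> (\<forall>k\<in>N2. dconv b a k = dunit k))"

definition dser :: "(nat \<times> nat \<Rightarrow> complex) \<Rightarrow> complex \<Rightarrow> complex \<Rightarrow> complex" where
  "dser a s1 s2 = (\<Sum>\<^sub>\<infinity>(m, n)\<in>N2. a (m, n) * of_nat m powr (- s1) * of_nat n powr (- s2))"

definition has_abs_dirichlet :: "(complex \<Rightarrow> complex \<Rightarrow> complex) \<Rightarrow> bool" where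
  "has_abs_dirichlet f \<longleftrightarrow> (\<exists>a \<in> l1. \<forall>s1\<in>HH. \<forall>s2\<in>HH. f s1 s2 = dser a s1 s2)"

definition bounded_away_zero :: "(complex \<Rightarrow> complex \<Rightarrow> complex) \<Rightarrow> bool" where
  "bounded_away_zero f \<longleftrightarrow> (\<exists>k>0. \<forall>s1\<in>HH. \<forall>s2\<in>HH. k \<le> norm (f s1 s2))"

end

theory Submission
  imports Defs "HOL-Complex_Analysis.Cauchy_Integral_Theorem"
begin

text \<open>
  The substance is that a series \<open>a\<close> bounded away from zero is invertible. Split \<open>a = g - h\<close> with \<open>g\<close>
  a Dirichlet polynomial and \<open>h\<close> small in \<open>\<ell>\<^sup>1\<close>, and expand \<open>1 / a = (\<Sum>N. h ^ N / g ^ (N + 1))\<close>. This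
  converges in \<open>\<ell>\<^sup>1\<close> once the norm of \<open>1 / g ^ N\<close> is at most \<open>Z / K ^ N\<close> with \<open>K\<close> larger than
  the norm of \<open>h\<close>. Being a Dirichlet polynomial, \<open>g\<close> satisfies \<open>\<bar>g\<bar> \<ge> K\<close> even for
  \<open>Re s\<^sub>1, Re s\<^sub>2 \<ge> -\<delta>\<close>, for some \<open>\<delta> > 0\<close>. Far to the right \<open>1 / g ^ N\<close> is an absolutely
  convergent Dirichlet series by a Neumann series, and shifting the mean value formula for its
  coefficients to the line \<open>Re w = -\<delta>\<close> along \<open>w \<mapsto> (w, \<theta> w)\<close> bounds the coefficient at
  \<open>(m, n)\<close> by \<open>(m n\<^sup>\<theta>)\<close> to the power \<open>-\<delta>\<close>, times \<open>1 / K ^ N\<close>. Only the finitely many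
  primes occurring in \<open>g\<close> enter the support, so these bounds are summable.
\<close>

subsection \<open>Coefficient bounds for general Dirichlet series\<close>

text \<open>The prescribed set \<open>K\<close> lets one truncation serve twice: with
  \<open>{j}\<close> it keeps the coefficient under study in the finite part, with \<open>{}\<close>
  it cuts a series down to a Dirichlet polynomial.\<close>

lemma summable_on_finite_tail:
  fixes q :: "'i \<Rightarrow> real"
  assumes q: "q summable_on I" and nonneg: "\<And>i. i \<in> I \<Longrightarrow> 0 \<le> q i"
    and e: "0 < e" and K: "finite K" "K \<subseteq> I"
  obtains J where "finite J" "J \<subseteq> I" "K \<subseteq> J" "infsum q (I - J) \<le> e"
proof -
  obtain F where F: "finite F" "F \<subseteq> I" "dist (sum q F) (infsum q I) \<le> e"
    using infsum_finite_approximation[OF q e] by blast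
  let ?J = "F \<union> K"
  have J: "finite ?J" "?J \<subseteq> I" using F K by auto
  have "infsum q I = infsum q ?J + infsum q (I - ?J)"
    using infsum_Un_disjoint[of q ?J "I - ?J"] J q summable_on_subset_banach[OF q, of "I - ?J"]
    by (simp add: Un_absorb1)
  moreover have "sum q F \<le> sum q ?J"
    using J nonneg by (intro sum_mono2) auto
  ultimately have "infsum q (I - ?J) \<le> e"
    using F(3) J by (auto simp: dist_real_def)
  with J that show thesis by blast
qed

lemma convex_Re_eq: "convex {w. Re w = x}"
proof -
  have "{w. Re w = x} = {w. x \<le> Re w} \<inter> {w. Re w \<le> x}" by auto
  then show ?thesis
    using convex_Int convex_halfspace_Re_ge convex_halfspace_Re_le by metis
qed

text \<open>
  The coefficient \<open>c j\<close> is the mean value of \<open>F w * exp (l j * w)\<close> on the line \<open>Re w = x1\<close>; Cauchy's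
  theorem moves this mean to the line \<open>Re w = x0\<close>. Working with a primitive \<open>\<Psi>\<close> of the
  integrand, every contour integral becomes a difference of values of \<open>\<Psi>\<close>.
\<close>

lemma dirichlet_coeff_bound:
  fixes c :: "'i \<Rightarrow> complex" and l :: "'i \<Rightarrow> real" and F :: "complex \<Rightarrow> complex"
  assumes holo: "F holomorphic_on {w. x0 \<le> Re w}"
    and bound: "\<And>w. x0 \<le> Re w \<Longrightarrow> norm (F w) \<le> M"
    and inj: "inj_on l I" and j: "j \<in> I" and x: "x0 \<le> x1"
    and summ: "(\<lambda>i. norm (c i) * exp (- l i * x1)) summable_on I"
    and rep: "\<And>w. Re w = x1 \<Longrightarrow> F w = (\<Sum>\<^sub>\<infinity>i\<in>I. c i * exp (- of_real (l i) * w))"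
  shows "norm (c j) \<le> M * exp (l j * x0)"
proof -
  define H where "H = {w. x0 \<le> Re w}"
  define \<Phi> where "\<Phi> w = F w * exp (of_real (l j) * w)" for w
  define d where "d i = l j - l i" for i
  \<comment> \<open>On the line \<open>Re w = x1\<close> the i-th term of \<open>\<Phi>\<close> has
    norm \<open>q i\<close> at every height, so a tail of \<open>q\<close> controls the tail of the
    series uniformly along the line.\<close>
  define q where "q i = norm (c i) * exp (d i * x1)" for i
  have M: "0 \<le> M" using order_trans[OF norm_ge_zero bound[of "of_real x0"]] by simp
  have convH: "convex H" unfolding H_def by (simp add: convex_halfspace_Re_ge)
  have holH: "\<Phi> holomorphic_on H"
    unfolding \<Phi>_def H_def by (intro holomorphic_intros holo)
  have "\<Phi> field_differentiable at w" if "w \<in> interior H - {}" for w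
    using that holomorphic_on_subset[OF holH interior_subset]
    by (simp add: holomorphic_on_imp_differentiable_at)
  then obtain \<Psi> where \<Psi>: "\<And>w. w \<in> H \<Longrightarrow> (\<Psi> has_field_derivative \<Phi> w) (at w within H)"
    using holomorphic_convex_primitive[OF convH finite.emptyI holomorphic_on_imp_continuous_on[OF holH]]
    by metis
  \<comment> \<open>\<open>B\<close> bounds \<open>\<Phi>\<close> on the strip between the two lines
    at every height, so the horizontal sides of the rectangle contribute a bounded amount while the
    vertical ones have length \<open>2 * T\<close>.\<close>
  define B where "B = M * exp (\<bar>l j\<bar> * (\<bar>x0\<bar> + \<bar>x1\<bar>))"
  have B0: "0 \<le> B" using M by (simp add: B_def)
  have norm\<Phi>: "norm (\<Phi> w) \<le> M * exp (l j * Re w)" if "x0 \<le> Re w" for w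
    unfolding \<Phi>_def norm_mult using bound[OF that] by (auto intro!: mult_right_mono)
  have horiz: "norm (\<Psi> (Complex x1 t) - \<Psi> (Complex x0 t)) \<le> B * (x1 - x0)" for t
  proof -
    let ?L = "H \<inter> {w. Re w \<le> x1}"
    have "norm (\<Psi> (Complex x1 t) - \<Psi> (Complex x0 t)) \<le> B * norm (Complex x1 t - Complex x0 t)"
    proof (rule field_differentiable_bound[of ?L _ \<Phi>])
      show "convex ?L" using convH by (intro convex_Int convex_halfspace_Re_le)
      show "(\<Psi> has_field_derivative \<Phi> z) (at z within ?L)" if "z \<in> ?L" for z
        using that by (intro DERIV_subset[OF \<Psi>]) auto
      show "norm (\<Phi> z) \<le> B" if "z \<in> ?L" for z
      proof -
        have z: "x0 \<le> Re z" "Re z \<le> x1" using that by (auto simp: H_def)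
        have "l j * Re z \<le> \<bar>l j\<bar> * \<bar>Re z\<bar>" by (metis abs_ge_self abs_mult)
        also have "\<dots> \<le> \<bar>l j\<bar> * (\<bar>x0\<bar> + \<bar>x1\<bar>)" using z by (intro mult_left_mono) auto
        finally show ?thesis using norm\<Phi>[OF z(1)] M unfolding B_def
          by (meson exp_le_cancel_iff mult_left_mono order_trans)
      qed
    qed (use x in \<open>auto simp: H_def\<close>)
    also have "norm (Complex x1 t - Complex x0 t) = x1 - x0"
      using x by (simp add: cmod_def)
    finally show ?thesis .
  qed
  have norm_pm: "norm (Complex x T - Complex x (-T)) = 2 * T" if "0 < T" for x T
    using that by (simp add: cmod_def real_sqrt_mult)
  have left: "norm (\<Psi> (Complex x0 T) - \<Psi> (Complex x0 (-T))) \<le> M * exp (l j * x0) * (2 * T)" if "0 < T" for T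
  proof -
    let ?L = "{w. Re w = x0}"
    have "norm (\<Psi> (Complex x0 T) - \<Psi> (Complex x0 (-T))) \<le> M * exp (l j * x0) * norm (Complex x0 T - Complex x0 (-T))"
    proof (rule field_differentiable_bound[of ?L _ \<Phi>])
      show "convex ?L" by (rule convex_Re_eq)
      show "(\<Psi> has_field_derivative \<Phi> z) (at z within ?L)" if "z \<in> ?L" for z
        using that by (intro DERIV_subset[OF \<Psi>]) (auto simp: H_def)
      show "norm (\<Phi> z) \<le> M * exp (l j * x0)" if "z \<in> ?L" for z
        using norm\<Phi>[of z] that by auto
    qed auto
    also have "norm (Complex x0 T - Complex x0 (-T)) = 2 * T"
      by (rule norm_pm[OF that])
    finally show ?thesis .
  qed
  have q_eq: "q i = exp (l j * x1) * (norm (c i) * exp (- l i * x1))" for i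
    by (simp add: q_def d_def algebra_simps flip: exp_add)
  have qs: "q summable_on I"
    unfolding q_eq by (intro summable_on_cmult_right summ)
  have q0: "0 \<le> q i" for i by (simp add: q_def)
  have normterm: "norm (c i * exp (of_real (d i) * w)) = q i" if "Re w = x1" for i w
    using that by (simp add: q_def norm_mult)
  have \<Phi>_line: "\<Phi> w = (\<Sum>\<^sub>\<infinity>i\<in>I. c i * exp (of_real (d i) * w))" if "Re w = x1" for w
  proof -
    have "\<Phi> w = (\<Sum>\<^sub>\<infinity>i\<in>I. c i * exp (- of_real (l i) * w) * exp (of_real (l j) * w))"
      unfolding \<Phi>_def rep[OF that] by (simp add: infsum_cmult_left')
    also have "\<dots> = (\<Sum>\<^sub>\<infinity>i\<in>I. c i * exp (of_real (d i) * w))"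
      by (intro infsum_cong) (simp add: d_def algebra_simps mult.assoc flip: exp_add)
    finally show ?thesis .
  qed
  have approx: "norm (c j) \<le> M * exp (l j * x0) + 2 * e" if e: "0 < e" for e
  proof -
    obtain J where J: "finite J" "J \<subseteq> I" "{j} \<subseteq> J" "infsum q (I - J) \<le> e"
      using summable_on_finite_tail[OF qs q0 e, of "{j}"] j by auto
    \<comment> \<open>A primitive of the retained terms with \<open>i \<noteq> j\<close>.
      Injectivity of \<open>l\<close> makes \<open>d i\<close> nonzero, and on the line
      \<open>E\<close> stays below \<open>E0\<close>, so these oscillating terms drop out of the
      mean.\<close>
    define E where "E w = (\<Sum>i\<in>J - {j}. c i * exp (of_real (d i) * w) / of_real (d i))" for w
    define E0 where "E0 = (\<Sum>i\<in>J - {j}. q i / \<bar>d i\<bar>)"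
    have dnz: "d i \<noteq> 0" if "i \<in> J - {j}" for i
      using inj j J(2) that by (auto simp: d_def inj_on_def)
    have normE: "norm (E w) \<le> E0" if "Re w = x1" for w
      unfolding E_def E0_def
      by (rule sum_norm_le) (use normterm[OF that] in \<open>simp add: norm_divide\<close>)
    have E0: "0 \<le> E0" unfolding E0_def using q0 by (intro sum_nonneg) auto
    have derE: "(E has_field_derivative (\<Sum>i\<in>J - {j}. c i * exp (of_real (d i) * w))) (at w within A)" for w A
      unfolding E_def
    proof (rule DERIV_sum)
      fix i assume "i \<in> J - {j}"
      from dnz[OF this] show "((\<lambda>w. c i * exp (of_real (d i) * w) / of_real (d i)) has_field_derivative
          c i * exp (of_real (d i) * w)) (at w within A)"
        by (auto intro!: derivative_eq_intros)
    qed
    let ?L = "{w. Re w = x1}"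
    \<comment> \<open>Once \<open>c j * w\<close> and \<open>E\<close> are removed, the derivative
      along the line is the discarded tail, of norm at most \<open>e\<close>.\<close>
    have right: "norm ((\<Psi> (Complex x1 T) - c j * Complex x1 T - E (Complex x1 T))
         - (\<Psi> (Complex x1 (-T)) - c j * Complex x1 (-T) - E (Complex x1 (-T)))) \<le> e * (2 * T)" if "0 < T" for T
    proof -
      have "norm ((\<Psi> (Complex x1 T) - c j * Complex x1 T - E (Complex x1 T))
         - (\<Psi> (Complex x1 (-T)) - c j * Complex x1 (-T) - E (Complex x1 (-T)))) \<le> e * norm (Complex x1 T - Complex x1 (-T))"
      proof (rule field_differentiable_bound[of ?L "\<lambda>w. \<Psi> w - c j * w - E w"
             "\<lambda>w. \<Phi> w - c j - (\<Sum>i\<in>J - {j}. c i * exp (of_real (d i) * w))"])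
        show "convex ?L" by (rule convex_Re_eq)
        show "((\<lambda>w. \<Psi> w - c j * w - E w) has_field_derivative
             \<Phi> z - c j - (\<Sum>i\<in>J - {j}. c i * exp (of_real (d i) * z))) (at z within ?L)" if "z \<in> ?L" for z
        proof -
          have "(\<Psi> has_field_derivative \<Phi> z) (at z within ?L)"
            using that x by (intro DERIV_subset[OF \<Psi>]) (auto simp: H_def)
          then show ?thesis by (auto intro!: derivative_eq_intros derE)
        qed
        show "norm (\<Phi> z - c j - (\<Sum>i\<in>J - {j}. c i * exp (of_real (d i) * z))) \<le> e" if "z \<in> ?L" for z
        proof -
          let ?f = "\<lambda>i. c i * exp (of_real (d i) * z)"
          have z: "Re z = x1" using that by simp
          have nsum: "(\<lambda>i. norm (?f i)) summable_on I"
            unfolding normterm[OF z] by (rule qs)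
          have fsum: "?f summable_on I" by (rule abs_summable_summable[OF nsum])
          have "infsum ?f I = infsum ?f J + infsum ?f (I - J)"
            using infsum_Un_disjoint[of ?f J "I - J"] J fsum summable_on_subset_banach[OF fsum, of "I - J"]
            by (simp add: Un_absorb1)
          also have "infsum ?f J = c j + (\<Sum>i\<in>J - {j}. ?f i)"
            using J by (simp add: sum.remove[of J j] d_def)
          finally have "\<Phi> z - c j - (\<Sum>i\<in>J - {j}. ?f i) = infsum ?f (I - J)"
            using \<Phi>_line[OF z] by simp
          also have "norm \<dots> \<le> infsum (\<lambda>i. norm (?f i)) (I - J)"
            using summable_on_subset_banach[OF nsum, of "I - J"] by (intro norm_infsum_bound) auto
          also have "\<dots> \<le> e" using J(4) unfolding normterm[OF z] .
          finally show ?thesis .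
        qed
      qed auto
      also have "norm (Complex x1 T - Complex x1 (-T)) = 2 * T"
        by (rule norm_pm[OF that])
      finally show ?thesis .
    qed
    \<comment> \<open>High enough that the bounded contributions \<open>E0\<close> and
      \<open>B * (x1 - x0)\<close> together amount to at most \<open>e\<close> after division by
      \<open>T\<close>; adding 1 keeps \<open>T\<close> positive.\<close>
    define T where "T = (E0 + B * (x1 - x0)) / e + 1"
    have T: "0 < T" using E0 B0 x e by (auto simp: T_def intro!: add_nonneg_pos divide_nonneg_pos)
    have T2: "E0 + B * (x1 - x0) \<le> e * T" using e by (simp add: T_def field_simps)
    let ?p = "Complex x1 T" let ?m = "Complex x1 (-T)"
    have tri: "norm z \<le> norm a + norm b + t" if "z = a - b - r" "norm r \<le> t" for z a b r :: complex and t
      using norm_triangle_ineq4[of "a - b" r] norm_triangle_ineq4[of a b] that by simp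
    have "norm (c j * (?p - ?m)) \<le> norm (\<Psi> ?p - \<Psi> ?m) + norm (E ?p - E ?m) + e * (2 * T)"
      by (rule tri[OF _ right[OF T]]) (simp add: algebra_simps)
    also have "norm (E ?p - E ?m) \<le> 2 * E0"
      using norm_triangle_ineq4[of "E ?p" "E ?m"] normE[of ?p] normE[of ?m] by simp
    also have "norm (\<Psi> ?p - \<Psi> ?m) \<le> 2 * (B * (x1 - x0)) + M * exp (l j * x0) * (2 * T)"
    proof -
      have "norm (\<Psi> ?p - \<Psi> ?m) \<le> norm (\<Psi> ?p - \<Psi> (Complex x0 T)) + norm (\<Psi> ?m - \<Psi> (Complex x0 (-T)))
          + M * exp (l j * x0) * (2 * T)"
        by (rule tri[where r = "- (\<Psi> (Complex x0 T) - \<Psi> (Complex x0 (-T)))"])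
          (use left[OF T] in \<open>simp_all only: norm_minus_cancel, simp\<close>)
      then show ?thesis
        using horiz[of T] horiz[of "-T"] by linarith
    qed
    also have "norm (c j * (?p - ?m)) = norm (c j) * (2 * T)"
      unfolding norm_mult norm_pm[OF T] ..
    finally have "norm (c j) * (2 * T) \<le> (M * exp (l j * x0) + 2 * e) * (2 * T)"
      using T2 by (simp add: algebra_simps)
    then show ?thesis using T by simp
  qed
  show ?thesis
  proof (rule field_le_epsilon)
    fix e :: real assume "0 < e"
    then show "norm (c j) \<le> M * exp (l j * x0) + e" using approx[of "e/2"] by simp
  qed
qed

subsection \<open>Double Dirichlet series and convolution\<close>

definition dmon :: "nat \<times> nat \<Rightarrow> complex \<Rightarrow> complex \<Rightarrow> complex" where
  "dmon k s1 s2 = of_nat (fst k) powr (- s1) * of_nat (snd k) powr (- s2)"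

definition dmult :: "nat \<times> nat \<Rightarrow> nat \<times> nat \<Rightarrow> nat \<times> nat" where
  "dmult k l = (fst k * fst l, snd k * snd l)"

lemma dser_eq: "dser a s1 s2 = (\<Sum>\<^sub>\<infinity>k\<in>N2. a k * dmon k s1 s2)"
  unfolding dser_def dmon_def by (intro infsum_cong) (auto simp: mult.assoc)

lemma N2_iff: "k \<in> N2 \<longleftrightarrow> 0 < fst k \<and> 0 < snd k"
  by (cases k) (auto simp: N2_def)

lemma norm_dmon:
  assumes "k \<in> N2"
  shows "norm (dmon k s1 s2) = real (fst k) powr (- Re s1) * real (snd k) powr (- Re s2)"
  using assms by (simp add: dmon_def norm_mult norm_powr_real_powr N2_iff)

lemma powr_le_1: "1 \<le> x \<Longrightarrow> y \<le> 0 \<Longrightarrow> x powr y \<le> (1::real)"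
  using powr_mono[of y 0 x] by simp

lemma norm_dmon_le_1:
  assumes "k \<in> N2" "s1 \<in> HH" "s2 \<in> HH"
  shows "norm (dmon k s1 s2) \<le> 1"
  using assms unfolding norm_dmon[OF assms(1)] HH_def N2_iff
  by (intro mult_le_one powr_le_1) auto

text \<open>Complex powers are multiplicative here because the bases are nonnegative reals.\<close>

lemma dmon_mult:
  "dmon (dmult k l) s1 s2 = dmon k s1 s2 * dmon l s1 s2"
proof -
  have "of_nat (m * n) powr s = (of_nat m powr s * of_nat n powr s :: complex)" for m n :: nat and s
    using powr_times_real[of "of_nat m" "of_nat n" s] by simp
  then show ?thesis by (simp add: dmon_def dmult_def)
qed

lemma dmon_add:
  "dmon k (s1 + t1) (s2 + t2) = dmon k s1 s2 * dmon k t1 t2"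
  by (simp only: dmon_def minus_add_distrib powr_add mult_ac)

lemma dmon_one [simp]: "dmon (1, 1) s1 s2 = 1"
  by (simp add: dmon_def)

lemma abs_summable_dser:
  assumes "(\<lambda>k. norm (c k)) summable_on N2" "s1 \<in> HH" "s2 \<in> HH"
  shows "(\<lambda>k. norm (c k * dmon k s1 s2)) summable_on N2"
  using assms(1)
proof (rule Infinite_Sum.abs_summable_on_comparison_test')
  fix k assume "k \<in> N2"
  then show "norm (c k * dmon k s1 s2) \<le> norm (c k)"
    using norm_dmon_le_1[OF _ assms(2,3)] by (simp add: norm_mult mult_left_le)
qed

lemma norm_dser_le:
  assumes "(\<lambda>k. norm (c k)) summable_on N2" "s1 \<in> HH" "s2 \<in> HH"
  shows "norm (dser c s1 s2) \<le> (\<Sum>\<^sub>\<infinity>k\<in>N2. norm (c k))"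
proof -
  have "norm (dser c s1 s2) \<le> (\<Sum>\<^sub>\<infinity>k\<in>N2. norm (c k * dmon k s1 s2))"
    unfolding dser_eq by (rule norm_infsum_bound[OF abs_summable_dser[OF assms]])
  also have "\<dots> \<le> (\<Sum>\<^sub>\<infinity>k\<in>N2. norm (c k))"
    using norm_dmon_le_1[OF _ assms(2,3)]
    by (intro infsum_mono abs_summable_dser assms) (simp add: norm_mult mult_left_le)
  finally show ?thesis .
qed

lemma dser_cong:
  assumes "\<And>k. k \<in> N2 \<Longrightarrow> a k = b k"
  shows "dser a s1 s2 = dser b s1 s2"
  unfolding dser_eq using assms by (intro infsum_cong) auto

lemma dser_diff:
  assumes "(\<lambda>k. norm (a k)) summable_on N2" "(\<lambda>k. norm (b k)) summable_on N2" "s1 \<in> HH" "s2 \<in> HH"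
  shows "dser (\<lambda>k. a k - b k) s1 s2 = dser a s1 s2 - dser b s1 s2"
proof -
  have "((\<lambda>k. a k * dmon k s1 s2 + - (b k * dmon k s1 s2)) has_sum (dser a s1 s2 + - dser b s1 s2)) N2"
    unfolding dser_eq
    by (intro has_sum_add has_sum_uminusI has_sum_infsum
        abs_summable_summable[OF abs_summable_dser[OF assms(1,3,4)]]
        abs_summable_summable[OF abs_summable_dser[OF assms(2,3,4)]])
  then show ?thesis by (simp add: dser_eq infsumI algebra_simps)
qed

lemma N2_divisor:
  assumes "k \<in> N2" "u dvd fst k" "v dvd snd k"
  shows "(u, v) \<in> N2" "(fst k div u, snd k div v) \<in> N2"
    "dmult (u, v) (fst k div u, snd k div v) = k"
proof -
  have "0 < d \<and> 0 < m div d" if "d dvd m" "0 < m" for d m :: nat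
    using that by (auto elim!: dvdE)
  then show "(u, v) \<in> N2" "(fst k div u, snd k div v) \<in> N2"
    using assms by (auto simp: N2_iff)
  show "dmult (u, v) (fst k div u, snd k div v) = k"
    using assms by (simp add: dmult_def)
qed

text \<open>A pair \<open>(k, l)\<close> corresponds to its product \<open>dmult k l\<close>
  together with the divisor \<open>k\<close>; each product has finitely many divisors, so the inner
  sums are finite. The general codomain serves both the real series of norms and the complex
  one.\<close>

lemma has_sum_divisor_pairs:
  fixes f :: "(nat \<times> nat) \<times> (nat \<times> nat) \<Rightarrow> 'a :: {topological_comm_monoid_add,t3_space}"
  assumes "(f has_sum t) (N2 \<times> N2)"
  shows "((\<lambda>k. \<Sum>u | u dvd fst k. \<Sum>v | v dvd snd k. f ((u, v), (fst k div u, snd k div v))) has_sum t) N2"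
proof -
  let ?B = "\<lambda>k. {u. u dvd fst k} \<times> {v. v dvd snd k}"
  let ?h = "\<lambda>(k, u). (u, (fst k div fst u, snd k div snd u)) :: (nat \<times> nat) \<times> (nat \<times> nat)"
  have "((\<lambda>x. f (?h x)) has_sum t) (Sigma N2 ?B) \<longleftrightarrow> (f has_sum t) (N2 \<times> N2)"
  proof (rule has_sum_reindex_bij_witness[where j = ?h and i = "\<lambda>(k, l). (dmult k l, k)"])
    fix x assume "x \<in> Sigma N2 ?B"
    then obtain k u v where x: "x = (k, (u, v))" and "k \<in> N2" "u dvd fst k" "v dvd snd k" by auto
    from N2_divisor[OF this(2-)]
    show "(case ?h x of (k, l) \<Rightarrow> (dmult k l, k)) = x" "?h x \<in> N2 \<times> N2"
      by (simp_all add: x)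
  next
    fix x assume "x \<in> N2 \<times> N2"
    then show "?h (case x of (k, l) \<Rightarrow> (dmult k l, k)) = x" "(case x of (k, l) \<Rightarrow> (dmult k l, k)) \<in> Sigma N2 ?B"
      by (auto simp: N2_iff dmult_def)
  qed simp_all
  with assms have "((\<lambda>x. f (?h x)) has_sum t) (Sigma N2 ?B)" by simp
  then show ?thesis
  proof (rule has_sum_SigmaD)
    fix k assume k: "k \<in> N2"
    then have fin: "finite (?B k)" by (auto simp: N2_iff)
    show "((\<lambda>y. f (?h (k, y))) has_sum (\<Sum>u | u dvd fst k. \<Sum>v | v dvd snd k. f ((u, v), (fst k div u, snd k div v)))) (?B k)"
      by (rule has_sum_finiteI[OF fin]) (simp add: sum.cartesian_product case_prod_unfold)
  qed
qed

lemma dconv_eq: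
  "dconv a b k = (\<Sum>u | u dvd fst k. \<Sum>v | v dvd snd k. a (u, v) * b (fst k div u, snd k div v))"
  by (cases k) (simp add: dconv_def)

lemma summable_on_product:
  fixes a :: "'i \<Rightarrow> real" and b :: "'j \<Rightarrow> real"
  assumes "a summable_on I" "b summable_on J" "\<And>i. i \<in> I \<Longrightarrow> 0 \<le> a i" "\<And>j. j \<in> J \<Longrightarrow> 0 \<le> b j"
  shows "(\<lambda>(k, l). a k * b l) summable_on I \<times> J"
    and "infsum (\<lambda>(k, l). a k * b l) (I \<times> J) = infsum a I * infsum b J"
proof -
  show s: "(\<lambda>(k, l). a k * b l) summable_on I \<times> J"
    using assms by (intro summable_on_SigmaI[where g = "\<lambda>k. a k * infsum b J"])
      (auto intro!: has_sum_cmult_right summable_on_cmult_left)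
  show "infsum (\<lambda>(k, l). a k * b l) (I \<times> J) = infsum a I * infsum b J"
    using infsum_Sigma'_banach[OF s] by (simp add: infsum_cmult_right' infsum_cmult_left')
qed

text \<open>All three facts regroup the product of two absolutely convergent series over
  \<open>N2 \<times> N2\<close> by divisor pairs. The auxiliary \<open>nab\<close>, the convolution
  of the norms, dominates \<open>dconv a b\<close> and has the product of the two norms as its
  total.\<close>

lemma dconv_l1:
  assumes a: "(\<lambda>k. norm (a k)) summable_on N2" and b: "(\<lambda>k. norm (b k)) summable_on N2"
  shows dconv_summable: "(\<lambda>k. norm (dconv a b k)) summable_on N2"
    and dconv_norm_le: "(\<Sum>\<^sub>\<infinity>k\<in>N2. norm (dconv a b k)) \<le> (\<Sum>\<^sub>\<infinity>k\<in>N2. norm (a k)) * (\<Sum>\<^sub>\<infinity>k\<in>N2. norm (b k))"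
    and dser_dconv: "s1 \<in> HH \<Longrightarrow> s2 \<in> HH \<Longrightarrow> dser (dconv a b) s1 s2 = dser a s1 s2 * dser b s1 s2"
proof -
  define nab where "nab k = (\<Sum>u | u dvd fst k. \<Sum>v | v dvd snd k. norm (a (u, v)) * norm (b (fst k div u, snd k div v)))" for k
  have "((\<lambda>(k, l). norm (a k) * norm (b l)) has_sum
      ((\<Sum>\<^sub>\<infinity>k\<in>N2. norm (a k)) * (\<Sum>\<^sub>\<infinity>k\<in>N2. norm (b k)))) (N2 \<times> N2)"
    using summable_on_product[OF a b] by (simp add: has_sum_iff)
  from has_sum_divisor_pairs[OF this]
  have nab: "(nab has_sum ((\<Sum>\<^sub>\<infinity>k\<in>N2. norm (a k)) * (\<Sum>\<^sub>\<infinity>k\<in>N2. norm (b k)))) N2"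
    unfolding nab_def by simp
  have le: "norm (dconv a b k) \<le> nab k" for k
    unfolding nab_def dconv_eq by (intro sum_norm_le) (auto simp: norm_mult intro!: sum_norm_le)
  show s: "(\<lambda>k. norm (dconv a b k)) summable_on N2"
    using has_sum_imp_summable[OF nab] le by (rule Infinite_Sum.abs_summable_on_comparison_test')
  show "(\<Sum>\<^sub>\<infinity>k\<in>N2. norm (dconv a b k)) \<le> (\<Sum>\<^sub>\<infinity>k\<in>N2. norm (a k)) * (\<Sum>\<^sub>\<infinity>k\<in>N2. norm (b k))"
    by (rule has_sum_mono[OF has_sum_infsum[OF s] nab]) (rule le)
  assume H: "s1 \<in> HH" "s2 \<in> HH"
  let ?a = "\<lambda>k. a k * dmon k s1 s2" and ?b = "\<lambda>k. b k * dmon k s1 s2"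
  let ?f = "\<lambda>(k, l). ?a k * ?b l"
  have "(\<lambda>x. norm (?f x)) summable_on N2 \<times> N2"
    using summable_on_product(1)[OF abs_summable_dser[OF a H] abs_summable_dser[OF b H]]
    by (simp add: case_prod_unfold norm_mult)
  then have fs: "?f summable_on N2 \<times> N2" by (rule abs_summable_summable)
  have "infsum ?f (N2 \<times> N2) = dser a s1 s2 * dser b s1 s2"
    unfolding dser_eq using infsum_Sigma'_banach[OF fs]
    by (simp add: infsum_cmult_right' infsum_cmult_left')
  with fs have "(?f has_sum (dser a s1 s2 * dser b s1 s2)) (N2 \<times> N2)"
    by (simp add: has_sum_iff)
  from has_sum_divisor_pairs[OF this]
  have "((\<lambda>k. \<Sum>u | u dvd fst k. \<Sum>v | v dvd snd k. ?f ((u, v), (fst k div u, snd k div v)))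
     has_sum (dser a s1 s2 * dser b s1 s2)) N2" .
  also have "?this \<longleftrightarrow> ((\<lambda>k. dconv a b k * dmon k s1 s2) has_sum (dser a s1 s2 * dser b s1 s2)) N2"
  proof (rule has_sum_cong)
    fix k assume k: "k \<in> N2"
    have *: "?f ((u, v), (fst k div u, snd k div v)) = a (u, v) * b (fst k div u, snd k div v) * dmon k s1 s2"
      if "u dvd fst k" "v dvd snd k" for u v
    proof -
      have "dmon k s1 s2 = dmon (u, v) s1 s2 * dmon (fst k div u, snd k div v) s1 s2"
        using dmon_mult[of "(u, v)" "(fst k div u, snd k div v)"] N2_divisor(3)[OF k that] by simp
      then show ?thesis by simp
    qed
    show "(\<Sum>u | u dvd fst k. \<Sum>v | v dvd snd k. ?f ((u, v), (fst k div u, snd k div v))) = dconv a b k * dmon k s1 s2"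
      unfolding dconv_eq sum_distrib_right using * by (intro sum.cong) auto
  qed
  finally show "dser (dconv a b) s1 s2 = dser a s1 s2 * dser b s1 s2"
    unfolding dser_eq by (rule infsumI)
qed

section \<open>The algebra of absolutely convergent Dirichlet series, with control of support and
  norm\<close>

definition submonoid2 :: "(nat \<times> nat) set \<Rightarrow> bool" where
  "submonoid2 S \<longleftrightarrow> (1, 1) \<in> S \<and> (\<forall>k\<in>S. \<forall>l\<in>S. dmult k l \<in> S)"

text \<open>The function side of l1. \<open>C\<close> bounds the norm of some coefficient function,
  whose uniqueness is established later. \<open>S\<close> records the support, so that it can be
  kept among numbers with finitely many primes, where the decay bounds are summable.\<close>

definition dirichlet_alg :: "(nat \<times> nat) set \<Rightarrow> real \<Rightarrow> (complex \<Rightarrow> complex \<Rightarrow> complex) \<Rightarrow> bool" where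
  "dirichlet_alg S C f \<longleftrightarrow> (\<exists>c. (\<forall>k\<in>N2 - S. c k = 0) \<and> (\<lambda>k. norm (c k)) summable_on N2
      \<and> (\<Sum>\<^sub>\<infinity>k\<in>N2. norm (c k)) \<le> C \<and> (\<forall>s1\<in>HH. \<forall>s2\<in>HH. f s1 s2 = dser c s1 s2))"

lemma submonoid2_N2: "submonoid2 N2"
  by (auto simp: submonoid2_def N2_iff dmult_def)

lemma dirichlet_alg_nonneg: "dirichlet_alg S C f \<Longrightarrow> 0 \<le> C"
  unfolding dirichlet_alg_def by (meson infsum_nonneg norm_ge_zero order_trans)

lemma dirichlet_alg_norm_le:
  "dirichlet_alg S C f \<Longrightarrow> s1 \<in> HH \<Longrightarrow> s2 \<in> HH \<Longrightarrow> norm (f s1 s2) \<le> C"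
  unfolding dirichlet_alg_def by (metis norm_dser_le order_trans)

lemma dirichlet_alg_cong:
  assumes "dirichlet_alg S C f" "\<And>s1 s2. s1 \<in> HH \<Longrightarrow> s2 \<in> HH \<Longrightarrow> f s1 s2 = g s1 s2"
  shows "dirichlet_alg S C g"
  using assms unfolding dirichlet_alg_def by metis

lemma dirichlet_algI:
  assumes "\<And>k. k \<in> N2 - S \<Longrightarrow> c k = 0" "(\<lambda>k. norm (c k)) summable_on N2"
    "(\<Sum>\<^sub>\<infinity>k\<in>N2. norm (c k)) \<le> C"
  shows "dirichlet_alg S C (dser c)"
  using assms unfolding dirichlet_alg_def by blast

lemma dirichlet_algE:
  assumes "dirichlet_alg S C f"
  obtains c where "\<And>k. k \<in> N2 - S \<Longrightarrow> c k = 0" "(\<lambda>k. norm (c k)) summable_on N2"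
    "(\<Sum>\<^sub>\<infinity>k\<in>N2. norm (c k)) \<le> C" "\<And>s1 s2. s1 \<in> HH \<Longrightarrow> s2 \<in> HH \<Longrightarrow> f s1 s2 = dser c s1 s2"
  using assms unfolding dirichlet_alg_def by blast

lemma dirichlet_alg_mono: "dirichlet_alg S C f \<Longrightarrow> S \<subseteq> S' \<Longrightarrow> C \<le> C' \<Longrightarrow> dirichlet_alg S' C' f"
proof (elim dirichlet_algE)
  fix c assume S: "S \<subseteq> S'" "C \<le> C'" and c: "\<And>k. k \<in> N2 - S \<Longrightarrow> c k = 0" "(\<lambda>k. norm (c k)) summable_on N2"
    "(\<Sum>\<^sub>\<infinity>k\<in>N2. norm (c k)) \<le> C" "\<And>s1 s2. s1 \<in> HH \<Longrightarrow> s2 \<in> HH \<Longrightarrow> f s1 s2 = dser c s1 s2"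
  have "dirichlet_alg S' C' (dser c)" using S c(1-3) by (intro dirichlet_algI) auto
  then show ?thesis by (rule dirichlet_alg_cong) (simp add: c(4))
qed

lemma dirichlet_alg_mult:
  assumes S: "submonoid2 S" and f: "dirichlet_alg S C f" and g: "dirichlet_alg S D g"
  shows "dirichlet_alg S (C * D) (\<lambda>s1 s2. f s1 s2 * g s1 s2)"
proof -
  obtain a where a: "\<And>k. k \<in> N2 - S \<Longrightarrow> a k = 0" "(\<lambda>k. norm (a k)) summable_on N2"
    "(\<Sum>\<^sub>\<infinity>k\<in>N2. norm (a k)) \<le> C" "\<And>s1 s2. s1 \<in> HH \<Longrightarrow> s2 \<in> HH \<Longrightarrow> f s1 s2 = dser a s1 s2"
    using dirichlet_algE[OF f] by blast
  obtain b where b: "\<And>k. k \<in> N2 - S \<Longrightarrow> b k = 0" "(\<lambda>k. norm (b k)) summable_on N2"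
    "(\<Sum>\<^sub>\<infinity>k\<in>N2. norm (b k)) \<le> D" "\<And>s1 s2. s1 \<in> HH \<Longrightarrow> s2 \<in> HH \<Longrightarrow> g s1 s2 = dser b s1 s2"
    using dirichlet_algE[OF g] by blast
  have "dirichlet_alg S (C * D) (dser (dconv a b))"
  proof (rule dirichlet_algI)
    show "(\<lambda>k. norm (dconv a b k)) summable_on N2" by (rule dconv_summable[OF a(2) b(2)])
    show "(\<Sum>\<^sub>\<infinity>k\<in>N2. norm (dconv a b k)) \<le> C * D"
      by (rule order_trans[OF dconv_norm_le[OF a(2) b(2)]])
         (intro mult_mono a(3) b(3) infsum_nonneg norm_ge_zero dirichlet_alg_nonneg[OF f])
    fix k assume k: "k \<in> N2 - S"
    have "a (u, v) * b (fst k div u, snd k div v) = 0" if "u dvd fst k" "v dvd snd k" for u v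
    proof -
      have N: "(u, v) \<in> N2" "(fst k div u, snd k div v) \<in> N2"
          "dmult (u, v) (fst k div u, snd k div v) = k"
        using N2_divisor[of k u v] that k by auto
      with k S have "(u, v) \<notin> S \<or> (fst k div u, snd k div v) \<notin> S"
        unfolding submonoid2_def by (metis DiffD2)
      with N a(1) b(1) show ?thesis by auto
    qed
    then show "dconv a b k = 0" unfolding dconv_eq by (intro sum.neutral ballI) simp
  qed
  then show ?thesis
    by (rule dirichlet_alg_cong) (simp add: dser_dconv[OF a(2) b(2)] a(4) b(4))
qed

lemma dser_dunit: "dser (\<lambda>k. z * dunit k) s1 s2 = z"
proof -
  have "((\<lambda>k. z * dunit k * dmon k s1 s2) has_sum z) N2"
    by (rule has_sum_finite_neutralI[of "{(1,1)}"]) (auto simp: N2_def dunit_def dmon_def)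
  then show ?thesis by (simp add: dser_eq infsumI)
qed

lemma dirichlet_alg_const:
  assumes "submonoid2 S"
  shows "dirichlet_alg S (norm z) (\<lambda>_ _. z)"
proof -
  have "((\<lambda>k. norm (z * dunit k)) has_sum norm z) N2"
    by (rule has_sum_finite_neutralI[of "{(1,1)}"]) (auto simp: N2_def dunit_def)
  moreover have "z * dunit k = 0" if "k \<in> N2 - S" for k
    using that assms by (auto simp: dunit_def submonoid2_def)
  ultimately have "dirichlet_alg S (norm z) (dser (\<lambda>k. z * dunit k))"
    by (intro dirichlet_algI) (auto simp: has_sum_iff)
  then show ?thesis by (rule dirichlet_alg_cong) (simp add: dser_dunit)
qed

lemma dirichlet_alg_power:
  assumes S: "submonoid2 S" and f: "dirichlet_alg S C f"
  shows "dirichlet_alg S (C ^ n) (\<lambda>s1 s2. f s1 s2 ^ n)"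
proof (induction n)
  case 0
  then show ?case using dirichlet_alg_const[OF S, of 1] by simp
next
  case (Suc n)
  then show ?case using dirichlet_alg_mult[OF S f Suc] by simp
qed

text \<open>Completeness of l1 on the function side: coefficients are summed over \<open>n\<close>
  separately for each \<open>k\<close>, and Fubini is applied twice, first to the norms for the
  bound, then to the terms with monomials to identify the sum with \<open>F\<close>.\<close>

lemma dirichlet_alg_sums:
  fixes C :: "nat \<Rightarrow> real"
  assumes f: "\<And>n. dirichlet_alg S (C n) (f n)" and C: "summable C"
    and F: "\<And>s1 s2. s1 \<in> HH \<Longrightarrow> s2 \<in> HH \<Longrightarrow> (\<lambda>n. f n s1 s2) sums F s1 s2"
  shows "dirichlet_alg S (suminf C) F"
proof -
  obtain c where c: "\<And>n k. k \<in> N2 - S \<Longrightarrow> c n k = 0" "\<And>n. (\<lambda>k. norm (c n k)) summable_on N2"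
    "\<And>n. (\<Sum>\<^sub>\<infinity>k\<in>N2. norm (c n k)) \<le> C n" "\<And>n s1 s2. s1 \<in> HH \<Longrightarrow> s2 \<in> HH \<Longrightarrow> f n s1 s2 = dser (c n) s1 s2"
    using f unfolding dirichlet_alg_def by metis
  have C0: "0 \<le> C n" for n using dirichlet_alg_nonneg[OF f] .
  define q where "q n = (\<Sum>\<^sub>\<infinity>k\<in>N2. norm (c n k))" for n
  have q0: "0 \<le> q n" for n unfolding q_def by (intro infsum_nonneg) auto
  have Cs: "C summable_on UNIV" using C C0 by (simp add: summable_on_UNIV_nonneg_real_iff)
  have Csum: "infsum C UNIV = suminf C"
    using has_sum_imp_sums[OF has_sum_infsum[OF Cs]] by (simp add: sums_iff)
  have qs: "q summable_on UNIV"
    by (rule summable_on_comparison_test[OF Cs]) (use c(3) q0 in \<open>auto simp: q_def\<close>)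
  have ns: "(\<lambda>(n, k). norm (c n k)) summable_on UNIV \<times> N2"
    by (rule summable_on_SigmaI[where g = q]) (use c(2) qs in \<open>auto simp: q_def\<close>)
  have ns': "(\<lambda>(k, n). norm (c n k)) summable_on N2 \<times> UNIV"
    using summable_on_swap[of "\<lambda>(n, k). norm (c n k)" UNIV N2] ns by (simp add: case_prod_unfold)
  have nk: "(\<lambda>n. norm (c n k)) summable_on UNIV" if "k \<in> N2" for k
    using summable_on_SigmaD1[OF ns' that] by simp
  define d where "d k = (\<Sum>\<^sub>\<infinity>n. c n k)" for k
  have dle: "norm (d k) \<le> (\<Sum>\<^sub>\<infinity>n. norm (c n k))" if "k \<in> N2" for k
    unfolding d_def using nk[OF that] by (rule norm_infsum_bound)
  have s1: "(\<lambda>k. \<Sum>\<^sub>\<infinity>n. norm (c n k)) summable_on N2"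
    using summable_on_Sigma_banach[OF ns'] by simp
  have ds: "(\<lambda>k. norm (d k)) summable_on N2"
    using s1 dle by (rule Infinite_Sum.abs_summable_on_comparison_test')
  have "(\<Sum>\<^sub>\<infinity>k\<in>N2. norm (d k)) \<le> (\<Sum>\<^sub>\<infinity>k\<in>N2. \<Sum>\<^sub>\<infinity>n. norm (c n k))"
    by (rule infsum_mono[OF ds s1 dle])
  also have "\<dots> = (\<Sum>\<^sub>\<infinity>n. \<Sum>\<^sub>\<infinity>k\<in>N2. norm (c n k))"
    using infsum_swap_banach[of "\<lambda>k n. norm (c n k)" N2 UNIV] ns' by simp
  also have "\<dots> \<le> suminf C"
    unfolding Csum[symmetric] q_def[symmetric] using c(3) by (intro infsum_mono qs Cs) (simp add: q_def)
  finally have dC: "(\<Sum>\<^sub>\<infinity>k\<in>N2. norm (d k)) \<le> suminf C" .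
  have "dirichlet_alg S (suminf C) (dser d)"
    using c(1) by (intro dirichlet_algI ds dC) (simp add: d_def)
  then show ?thesis
  proof (rule dirichlet_alg_cong)
    fix s1 s2 assume H: "s1 \<in> HH" "s2 \<in> HH"
    have "(\<lambda>x. norm (case x of (k, n) \<Rightarrow> c n k * dmon k s1 s2)) summable_on N2 \<times> UNIV"
      by (rule Infinite_Sum.abs_summable_on_comparison_test'[OF ns'])
         (use norm_dmon_le_1[OF _ H] in \<open>auto simp: norm_mult mult_left_le\<close>)
    then have cs: "(\<lambda>(k, n). c n k * dmon k s1 s2) summable_on N2 \<times> UNIV"
      by (rule abs_summable_summable)
    then have cs': "(\<lambda>(n, k). c n k * dmon k s1 s2) summable_on UNIV \<times> N2"
      using summable_on_swap[of "\<lambda>(n, k). c n k * dmon k s1 s2" UNIV N2] by (simp add: case_prod_unfold)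
    have "dser d s1 s2 = (\<Sum>\<^sub>\<infinity>k\<in>N2. \<Sum>\<^sub>\<infinity>n. c n k * dmon k s1 s2)"
      unfolding dser_eq d_def by (simp add: infsum_cmult_left')
    also have "\<dots> = (\<Sum>\<^sub>\<infinity>n. \<Sum>\<^sub>\<infinity>k\<in>N2. c n k * dmon k s1 s2)"
      by (rule infsum_swap_banach[OF cs])
    also have "\<dots> = (\<Sum>\<^sub>\<infinity>n. f n s1 s2)" by (simp add: c(4)[OF H] dser_eq)
    also have "\<dots> = F s1 s2"
    proof -
      have "(\<lambda>n. f n s1 s2) summable_on UNIV"
        using summable_on_Sigma_banach[OF cs'] by (simp add: c(4)[OF H] dser_eq)
      from has_sum_imp_sums[OF has_sum_infsum[OF this]] F[OF H] show ?thesis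
        by (simp add: sums_iff)
    qed
    finally show "dser d s1 s2 = F s1 s2" .
  qed
qed

text \<open>Neumann series: \<open>q < 1\<close> bounds \<open>h\<close> pointwise below 1, and the
  powers of \<open>h\<close> have norms at most \<open>q ^ n\<close>.\<close>

lemma dirichlet_alg_geometric:
  assumes S: "submonoid2 S" and h: "dirichlet_alg S q h" and q: "q < 1"
  shows "dirichlet_alg S (1 / (1 - q)) (\<lambda>s1 s2. 1 / (1 - h s1 s2))"
proof -
  have q0: "0 \<le> q" by (rule dirichlet_alg_nonneg[OF h])
  have "dirichlet_alg S (suminf (\<lambda>n. q ^ n)) (\<lambda>s1 s2. 1 / (1 - h s1 s2))"
  proof (rule dirichlet_alg_sums)
    show "dirichlet_alg S (q ^ n) (\<lambda>s1 s2. h s1 s2 ^ n)" for n by (rule dirichlet_alg_power[OF S h])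
    show "summable (\<lambda>n. q ^ n)" using q q0 by simp
    fix s1 s2 assume "s1 \<in> HH" "s2 \<in> HH"
    then have "norm (h s1 s2) < 1" using dirichlet_alg_norm_le[OF h] q by (meson le_less_trans)
    then show "(\<lambda>n. h s1 s2 ^ n) sums (1 / (1 - h s1 s2))" by (rule geometric_sums)
  qed
  then show ?thesis using q q0 by (simp add: suminf_geometric)
qed

subsection \<open>Decay and uniqueness of coefficients\<close>

text \<open>
  Along the line \<open>w \<mapsto> (w, \<theta> w)\<close> a double Dirichlet series becomes a one-variable one with
  frequencies \<open>ln m + \<theta> ln n\<close>; for all but countably many \<open>\<theta>\<close> no two of them coincide.
\<close>

lemma exists_injective_log_weights:
  obtains \<theta> :: real where "0 < \<theta>" "\<theta> < 1"
    "inj_on (\<lambda>k. ln (real (fst k)) + \<theta> * ln (real (snd k))) N2"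
proof -
  \<comment> \<open>For two given pairs with different second entries, only this quotient can make
    the frequencies coincide. Where the denominator is 0 the quotient is 0 by convention, which lies
    outside the open interval.\<close>
  define Q where "Q = (\<lambda>((m, n), (m', n')). (ln (real m) - ln (real m')) / (ln (real n') - ln (real n))) `
    (UNIV :: ((nat \<times> nat) \<times> (nat \<times> nat)) set)"
  have "countable Q" unfolding Q_def by simp
  then have "\<not> {0<..<1::real} \<subseteq> Q"
    using uncountable_open_interval[of 0 "1::real"] countable_subset by auto
  then obtain \<theta> where \<theta>: "0 < \<theta>" "\<theta> < 1" "\<theta> \<notin> Q" by (auto simp: subset_iff)
  have "inj_on (\<lambda>k. ln (real (fst k)) + \<theta> * ln (real (snd k))) N2"
  proof (rule inj_onI)
    fix k k' assume k: "k \<in> N2" "k' \<in> N2"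
      and eq: "ln (real (fst k)) + \<theta> * ln (real (snd k)) = ln (real (fst k')) + \<theta> * ln (real (snd k'))"
    have "snd k = snd k'"
    proof (rule ccontr)
      assume "snd k \<noteq> snd k'"
      then have "ln (real (snd k')) - ln (real (snd k)) \<noteq> 0" using k by (simp add: N2_iff)
      with eq have "\<theta> = (ln (real (fst k)) - ln (real (fst k'))) / (ln (real (snd k')) - ln (real (snd k)))"
        by (simp add: field_simps)
      then have "\<theta> \<in> Q" unfolding Q_def by (intro image_eqI[of _ _ "(k, k')"]) (auto simp: case_prod_unfold)
      with \<theta> show False by simp
    qed
    with eq k show "k = k'" by (simp add: N2_iff prod_eq_iff)
  qed
  with \<theta> that show thesis by blast
qed

lemma dmon_line:
  assumes "k \<in> N2"
  shows "dmon k w (of_real \<theta> * w) = exp (- of_real (ln (real (fst k)) + \<theta> * ln (real (snd k))) * w)"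
  using assms by (simp add: dmon_def N2_iff powr_def Ln_of_nat algebra_simps flip: exp_add)

text \<open>\<open>G\<close> is known as a Dirichlet series only far to the right, so its expansion
  is stated after a shift by \<open>(x1, \<theta> * x1)\<close>, with damped coefficients
  \<open>c\<close>. Undoing the damping gives \<open>b\<close>, which moving the line from
  \<open>x1\<close> to \<open>x0\<close> bounds; the exponent \<open>x0 - x1\<close> combines both
  effects.\<close>

lemma dser_coeff_decay:
  fixes G :: "complex \<Rightarrow> complex \<Rightarrow> complex"
  defines "l \<equiv> \<lambda>\<theta> k. ln (real (fst k)) + \<theta> * ln (real (snd k))"
  assumes inj: "inj_on (l \<theta>) N2"
    and holo: "(\<lambda>w. G w (of_real \<theta> * w)) holomorphic_on {w. x0 \<le> Re w}"
    and bound: "\<And>w. x0 \<le> Re w \<Longrightarrow> norm (G w (of_real \<theta> * w)) \<le> M"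
    and x: "x0 \<le> x1" and k: "k \<in> N2"
    and summ: "(\<lambda>k. norm (c k)) summable_on N2"
    and rep: "\<And>s1 s2. s1 \<in> HH \<Longrightarrow> s2 \<in> HH \<Longrightarrow> G (s1 + of_real x1) (s2 + of_real (\<theta> * x1)) = dser c s1 s2"
  shows "norm (c k) \<le> M * exp (l \<theta> k * (x0 - x1))"
proof -
  define b where "b k = c k * of_real (exp (l \<theta> k * x1))" for k
  have nb: "norm (b k) = norm (c k) * exp (l \<theta> k * x1)" for k
    by (simp add: b_def norm_mult)
  have "norm (b k) \<le> M * exp (l \<theta> k * x0)"
  proof (rule dirichlet_coeff_bound[OF holo bound inj k x])
    show "(\<lambda>i. norm (b i) * exp (- l \<theta> i * x1)) summable_on N2"
      using summ by (simp add: nb mult.assoc flip: exp_add)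
    fix w :: complex assume w: "Re w = x1"
    \<comment> \<open>The shift takes the imaginary axis to the line \<open>Re w = x1\<close>, so
      \<open>s\<close> and \<open>\<theta> * s\<close> lie on the boundary of
      \<open>HH\<close>.\<close>
    define s where "s = \<i> * of_real (Im w)"
    have ws: "w = s + of_real x1" using w by (simp add: s_def complex_eq_iff)
    have "G w (of_real \<theta> * w) = G (s + of_real x1) (of_real \<theta> * s + of_real (\<theta> * x1))"
      by (simp add: ws algebra_simps)
    also have "\<dots> = dser c s (of_real \<theta> * s)"
      by (rule rep) (auto simp: HH_def s_def)
    also have "\<dots> = (\<Sum>\<^sub>\<infinity>i\<in>N2. b i * exp (- of_real (l \<theta> i) * w))"
      unfolding dser_eq
    proof (rule infsum_cong)
      fix i assume i: "i \<in> N2"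
      have "b i * exp (- of_real (l \<theta> i) * w) = c i * (exp (of_real (l \<theta> i * x1)) * exp (- of_real (l \<theta> i) * w))"
        by (simp add: b_def flip: exp_of_real)
      also have "exp (of_real (l \<theta> i * x1)) * exp (- of_real (l \<theta> i) * w) = exp (- of_real (l \<theta> i) * s)"
        by (simp add: ws algebra_simps flip: exp_add)
      finally show "c i * dmon i s (of_real \<theta> * s) = b i * exp (- of_real (l \<theta> i) * w)"
        using dmon_line[OF i, of s \<theta>] by (simp add: l_def)
    qed
    finally show "G w (of_real \<theta> * w) = (\<Sum>\<^sub>\<infinity>i\<in>N2. b i * exp (- of_real (l \<theta> i) * w))" .
  qed
  then have "norm (c k) \<le> M * exp (l \<theta> k * x0) / exp (l \<theta> k * x1)"
    by (simp add: nb field_simps)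
  then show ?thesis by (simp add: right_diff_distrib exp_diff)
qed

text \<open>Uniqueness of coefficients is the degenerate case \<open>G = 0\<close>,
  \<open>M = 0\<close> of the decay bound, without moving the line.\<close>

lemma dser_eq_0_imp:
  assumes "(\<lambda>k. norm (c k)) summable_on N2"
    and "\<And>s1 s2. s1 \<in> HH \<Longrightarrow> s2 \<in> HH \<Longrightarrow> dser c s1 s2 = 0" and "k \<in> N2"
  shows "c k = 0"
proof -
  obtain \<theta> :: real where \<theta>: "inj_on (\<lambda>k. ln (real (fst k)) + \<theta> * ln (real (snd k))) N2"
    using exists_injective_log_weights .
  have "norm (c k) \<le> 0 * exp ((ln (real (fst k)) + \<theta> * ln (real (snd k))) * (0 - 0))"
    using assms by (intro dser_coeff_decay[OF \<theta>, where G = "\<lambda>_ _. 0"]) auto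
  then show ?thesis by simp
qed

lemma dunit_summable: "(\<lambda>k. norm (dunit k)) summable_on N2"
  by (rule has_sum_imp_summable[OF has_sum_finite_neutralI[of "{(1,1)}"]]) (auto simp: N2_def dunit_def)

lemma dser_eq_1_imp:
  assumes c: "(\<lambda>k. norm (c k)) summable_on N2"
    and 1: "\<And>s1 s2. s1 \<in> HH \<Longrightarrow> s2 \<in> HH \<Longrightarrow> dser c s1 s2 = 1" and k: "k \<in> N2"
  shows "c k = dunit k"
proof -
  have "c k - dunit k = 0"
  proof (rule dser_eq_0_imp[OF _ _ k])
    show "(\<lambda>k. norm (c k - dunit k)) summable_on N2"
      using summable_on_add[OF c dunit_summable] norm_triangle_ineq4
      by (rule Infinite_Sum.abs_summable_on_comparison_test')
    show "dser (\<lambda>k. c k - dunit k) s1 s2 = 0" if "s1 \<in> HH" "s2 \<in> HH" for s1 s2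
      using dser_diff[OF c dunit_summable that] 1[OF that] dser_dunit[of 1 s1 s2] by simp
  qed
  then show ?thesis by simp
qed

lemma dser_shift: "dser c (s1 + t1) (s2 + t2) = dser (\<lambda>k. c k * dmon k t1 t2) s1 s2"
  by (simp add: dser_eq dmon_add mult_ac)

section \<open>Summability over integers built from finitely many primes\<close>

definition smooth :: "nat set \<Rightarrow> nat set" where
  "smooth P = {m. 0 < m \<and> prime_factors m \<subseteq> P}"

text \<open>One factor of an Euler product at a time: splitting off the power of a new prime
  \<open>p\<close> compares the sum with a geometric series times the sum for
  \<open>P\<close>.\<close>

lemma smooth_powr_summable:
  assumes "finite P" "0 < (\<epsilon>::real)"
  shows "(\<lambda>m. real m powr (- \<epsilon>)) summable_on smooth P"
  using assms(1)
proof (induction P)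
  case empty
  have "smooth {} = {1}" by (auto simp: smooth_def prime_factorization_empty_iff)
  then show ?case by simp
next
  case (insert p P)
  show ?case
  proof (cases "prime p")
    case False
    then have "smooth (insert p P) = smooth P" by (auto simp: smooth_def)
    with insert show ?thesis by simp
  next
    case True
    then have p: "1 < real p" using prime_gt_1_nat[of p] by simp
    define h where "h = (\<lambda>(j, m). real (p ^ j) powr (- \<epsilon>) * real m powr (- \<epsilon>))"
    \<comment> \<open>The exponent of \<open>p\<close> in \<open>m\<close> and the cofactor free of
      \<open>p\<close>. Injectivity of \<open>\<phi>\<close> is enough, since summability passes to
      its image as a subset.\<close>
    define \<phi> where "\<phi> m = (multiplicity p m, m div p ^ multiplicity p m)" for m
    have dec: "m = p ^ fst (\<phi> m) * snd (\<phi> m)" for m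
      by (simp add: \<phi>_def multiplicity_dvd)
    have "(\<lambda>j. (real p powr (- \<epsilon>)) ^ j) summable_on UNIV"
      using p assms(2) by (intro norm_summable_imp_summable_on) (auto intro!: summable_geometric simp: powr_less_one)
    also have "(\<lambda>j. (real p powr (- \<epsilon>)) ^ j) = (\<lambda>j. real (p ^ j) powr (- \<epsilon>))"
      using p by (auto simp: powr_powr_swap powr_realpow[symmetric] fun_eq_iff)
    finally have "(\<lambda>j. real (p ^ j) powr (- \<epsilon>)) summable_on UNIV" .
    then have "h summable_on UNIV \<times> smooth P"
      unfolding h_def using insert.IH by (intro summable_on_product) auto
    moreover have "\<phi> ` smooth (insert p P) \<subseteq> UNIV \<times> smooth P"
    proof
      fix x assume "x \<in> \<phi> ` smooth (insert p P)"
      then obtain m where m: "x = \<phi> m" "0 < m" "prime_factors m \<subseteq> insert p P" by (auto simp: smooth_def)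
      have "\<not> p dvd snd (\<phi> m)"
        using multiplicity_decompose[of m p] True m(2) not_prime_unit by (auto simp: \<phi>_def)
      moreover have "snd (\<phi> m) dvd m" "0 < snd (\<phi> m)" using dec[of m] m(2) by (metis dvd_triv_right, metis gr0I mult_0_right)
      ultimately have "prime_factors (snd (\<phi> m)) \<subseteq> P"
        using m(2,3) dvd_prime_factors[of m "snd (\<phi> m)"] by auto
      with \<open>0 < snd (\<phi> m)\<close> show "x \<in> UNIV \<times> smooth P"
        unfolding m(1) by (cases "\<phi> m") (auto simp: smooth_def)
    qed
    ultimately have "h summable_on \<phi> ` smooth (insert p P)" by (rule summable_on_subset_banach)
    moreover have "inj_on \<phi> (smooth (insert p P))" by (metis dec inj_onI)
    ultimately have "(h \<circ> \<phi>) summable_on smooth (insert p P)" by (simp add: summable_on_reindex)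
    also have "h \<circ> \<phi> = (\<lambda>m. real m powr (- \<epsilon>))"
    proof
      fix m
      have "real m = real (p ^ fst (\<phi> m)) * real (snd (\<phi> m))" using dec[of m] by (metis of_nat_mult)
      then show "(h \<circ> \<phi>) m = real m powr (- \<epsilon>)"
        by (simp add: h_def case_prod_unfold powr_mult)
    qed
    finally show ?thesis .
  qed
qed

lemma submonoid2_smooth: "submonoid2 (smooth P \<times> smooth P)"
  by (auto simp: submonoid2_def smooth_def dmult_def prime_factors_product)

subsection \<open>Reciprocals of powers of Dirichlet polynomials\<close>

definition dpoly :: "(nat \<times> nat) set \<Rightarrow> (nat \<times> nat \<Rightarrow> complex) \<Rightarrow> complex \<Rightarrow> complex \<Rightarrow> complex" where
  "dpoly A g s1 s2 = (\<Sum>k\<in>A. g k * dmon k s1 s2)"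

lemma dirichlet_alg_dpoly:
  assumes "finite A" "A \<subseteq> S" "A \<subseteq> N2"
  shows "dirichlet_alg S (\<Sum>k\<in>A. norm (g k)) (dpoly A g)"
proof -
  let ?c = "\<lambda>k. if k \<in> A then g k else 0"
  have "((\<lambda>k. norm (?c k)) has_sum (\<Sum>k\<in>A. norm (g k))) N2"
    by (rule has_sum_finite_neutralI[of A]) (use assms in auto)
  then have "dirichlet_alg S (\<Sum>k\<in>A. norm (g k)) (dser ?c)"
    using assms by (intro dirichlet_algI) (auto simp: has_sum_iff)
  moreover have "dser ?c s1 s2 = dpoly A g s1 s2" for s1 s2
  proof -
    have "((\<lambda>k. ?c k * dmon k s1 s2) has_sum dpoly A g s1 s2) N2"
      by (rule has_sum_finite_neutralI[of A]) (use assms in \<open>auto simp: dpoly_def\<close>)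
    then show ?thesis by (simp add: dser_eq infsumI)
  qed
  ultimately show ?thesis using dirichlet_alg_cong by blast
qed

lemma dpoly_shift: "dpoly A g (s1 + t1) (s2 + t2) = dpoly A (\<lambda>k. g k * dmon k t1 t2) s1 s2"
  by (simp add: dpoly_def dmon_add mult_ac)

lemma dpoly_line_holomorphic:
  assumes "A \<subseteq> N2"
  shows "(\<lambda>w. dpoly A g w (of_real \<theta> * w)) holomorphic_on X"
proof -
  have "(\<lambda>w. dpoly A g w (of_real \<theta> * w)) =
      (\<lambda>w. \<Sum>k\<in>A. g k * exp (- of_real (ln (real (fst k)) + \<theta> * ln (real (snd k))) * w))"
    unfolding dpoly_def using assms by (intro ext sum.cong) (auto simp: dmon_line subset_iff)
  then show ?thesis by (simp only:) (intro holomorphic_intros)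
qed

text \<open>A pair other than \<open>(1, 1)\<close> has an entry at least 2, and the slower of the
  two rates, \<open>\<theta> * x\<close>, already gives this factor. All nonconstant monomials thus
  become uniformly small far to the right.\<close>

lemma norm_dmon_far:
  assumes k: "k \<in> N2" "k \<noteq> (1, 1)" and x: "0 \<le> x" "0 < \<theta>" "\<theta> < 1"
  shows "norm (dmon k (of_real x) (of_real (\<theta> * x))) \<le> 2 powr (- (\<theta> * x))"
proof -
  have tx: "0 \<le> \<theta> * x" "\<theta> * x \<le> x" using x by (auto intro: mult_left_le_one_le)
  have *: "real m powr (- y) \<le> 2 powr (- (\<theta> * x))" if "2 \<le> m" "\<theta> * x \<le> y" for m y
  proof -
    have "real m powr (- y) \<le> real m powr (- (\<theta> * x))" using that by (intro powr_mono) auto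
    also have "\<dots> \<le> 2 powr (- (\<theta> * x))" using that tx by (intro powr_mono2') auto
    finally show ?thesis .
  qed
  have **: "real m powr (- y) \<le> 1" if "1 \<le> m" "0 \<le> y" for m y
    using that by (intro powr_le_1) auto
  from k have "2 \<le> fst k \<or> 2 \<le> snd k" by (cases k) (auto simp: N2_iff)
  then have "real (fst k) powr (- x) * real (snd k) powr (- (\<theta> * x)) \<le> 2 powr (- (\<theta> * x))"
  proof
    assume "2 \<le> fst k"
    then have "real (fst k) powr (- x) * real (snd k) powr (- (\<theta> * x)) \<le> 2 powr (- (\<theta> * x)) * 1"
      using k tx by (intro mult_mono * **) (auto simp: N2_iff)
    then show ?thesis by simp
  next
    assume "2 \<le> snd k"
    then have "real (fst k) powr (- x) * real (snd k) powr (- (\<theta> * x)) \<le> 1 * 2 powr (- (\<theta> * x))"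
      using k tx x by (intro mult_mono * **) (auto simp: N2_iff)
    then show ?thesis by simp
  qed
  then show ?thesis by (simp add: norm_dmon[OF k(1)])
qed

text \<open>Far to the right the polynomial is close to its constant term \<open>u\<close>. The
  lower bound \<open>K\<close> survives there and forces \<open>norm u > K / 2\<close>, while the
  remaining terms have total norm \<open>r < K / 2\<close>; a Neumann series in the remainder
  divided by \<open>- u\<close> gives the inverse.\<close>

lemma dpoly_inverse_far:
  assumes S: "submonoid2 S" and A: "finite A" "A \<subseteq> S" "A \<subseteq> N2" and K: "0 < K"
    and lower: "\<And>s1 s2. s1 \<in> HH \<Longrightarrow> s2 \<in> HH \<Longrightarrow> K \<le> norm (dpoly A g s1 s2)"
    and \<theta>: "0 < \<theta>" "\<theta> < 1"
  obtains x C where "0 \<le> x"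
    "dirichlet_alg S C (\<lambda>s1 s2. 1 / dpoly A g (s1 + of_real x) (s2 + of_real (\<theta> * x)))"
proof -
  let ?A = "A - {(1, 1)}"
  define G where "G = (\<Sum>k\<in>A. norm (g k))"
  have G0: "0 \<le> G" unfolding G_def by (intro sum_nonneg) auto
  \<comment> \<open>\<open>G + 1\<close> keeps the denominator positive with only
    \<open>0 \<le> G\<close> at hand; \<open>x\<close> is then chosen so that
    \<open>2 powr (- (\<theta> * x))\<close> is exactly \<open>(1 / 2) ^ n\<close>.\<close>
  obtain n where n: "(1 / 2) ^ n < K / (2 * (G + 1))"
    using real_arch_pow_inv[of "K / (2 * (G + 1))" "1 / 2"] K G0 by auto
  define x where "x = real n / \<theta>"
  have pow: "2 powr (- (\<theta> * x)) = (1 / 2) ^ n"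
    using \<theta> by (simp add: x_def powr_minus powr_realpow power_one_over inverse_eq_divide)
  have "G * 2 powr (- (\<theta> * x)) \<le> (G + 1) * (1 / 2) ^ n" unfolding pow by (intro mult_right_mono) auto
  also have "\<dots> < K / 2" using n G0 by (simp add: field_simps)
  finally have x: "G * 2 powr (- (\<theta> * x)) < K / 2" "0 \<le> x" using \<theta> by (auto simp: x_def)
  define h where "h k = g k * dmon k (of_real x) (of_real (\<theta> * x))" for k
  define r where "r = (\<Sum>k\<in>?A. norm (h k))"
  define u where "u = (if (1, 1) \<in> A then g (1, 1) else 0)"
  have "r \<le> (\<Sum>k\<in>?A. norm (g k) * 2 powr (- (\<theta> * x)))"
    unfolding r_def h_def norm_mult using norm_dmon_far[OF _ _ x(2) \<theta>] A
    by (intro sum_mono mult_left_mono) auto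
  also have "\<dots> \<le> (\<Sum>k\<in>A. norm (g k) * 2 powr (- (\<theta> * x)))"
    using A by (intro sum_mono2) auto
  also have "\<dots> = G * 2 powr (- (\<theta> * x))" by (simp add: G_def sum_distrib_right)
  finally have r: "r < K / 2" using x by simp
  have split: "dpoly A g (s1 + of_real x) (s2 + of_real (\<theta> * x)) = u + dpoly ?A h s1 s2" for s1 s2
  proof -
    have "dpoly A g (s1 + of_real x) (s2 + of_real (\<theta> * x)) = dpoly A h s1 s2"
      unfolding dpoly_shift h_def ..
    also have "\<dots> = u + dpoly ?A h s1 s2"
      using A dmon_one[of s1 s2] dmon_one[of "of_real x" "of_real (\<theta> * x)"]
      by (simp add: dpoly_def u_def h_def sum.remove[of A "(1, 1)"])
    finally show ?thesis .
  qed
  have R: "dirichlet_alg S r (dpoly ?A h)"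
    unfolding r_def using A by (intro dirichlet_alg_dpoly) auto
  have "K \<le> norm (u + dpoly ?A h 0 0)"
    using lower[of "0 + of_real x" "0 + of_real (\<theta> * x)"] x \<theta> unfolding split by (auto simp: HH_def)
  also have "\<dots> \<le> norm u + r"
    using norm_triangle_ineq[of u "dpoly ?A h 0 0"] dirichlet_alg_norm_le[OF R, of 0 0] by (simp add: HH_def)
  finally have u: "K / 2 < norm u" using r by simp
  have u0: "u \<noteq> 0" using u K by auto
  have "dirichlet_alg S (norm (- 1 / u) * r) (\<lambda>s1 s2. (- 1 / u) * dpoly ?A h s1 s2)"
    by (rule dirichlet_alg_mult[OF S dirichlet_alg_const[OF S] R])
  moreover have "norm (- 1 / u) * r < 1"
    using r u K by (simp add: norm_divide divide_less_eq)
  ultimately have "dirichlet_alg S (1 / (1 - norm (- 1 / u) * r)) (\<lambda>s1 s2. 1 / (1 - (- 1 / u) * dpoly ?A h s1 s2))"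
    by (rule dirichlet_alg_geometric[OF S])
  from dirichlet_alg_mult[OF S dirichlet_alg_const[OF S, of "1 / u"] this]
  have "dirichlet_alg S (norm (1 / u) * (1 / (1 - norm (- 1 / u) * r)))
    (\<lambda>s1 s2. 1 / dpoly A g (s1 + of_real x) (s2 + of_real (\<theta> * x)))"
  proof (rule dirichlet_alg_cong)
    fix s1 s2
    have "1 - (- 1 / u) * dpoly ?A h s1 s2 = (u + dpoly ?A h s1 s2) / u"
      using u0 by (simp add: field_simps)
    then show "1 / u * (1 / (1 - (- 1 / u) * dpoly ?A h s1 s2)) =
        1 / dpoly A g (s1 + of_real x) (s2 + of_real (\<theta> * x))"
      unfolding split using u0 by simp
  qed
  with x that show thesis by blast
qed

text \<open>The point is that \<open>Z\<close> is uniform in \<open>N\<close>. The Neumann bound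
  \<open>C ^ N\<close> only guarantees an expansion far to the right; the size of the coefficients
  is then estimated afresh from the bound \<open>1 / K\<close> on the line
  \<open>Re w = - \<delta>\<close>.\<close>

lemma dpoly_inverse_powers:
  assumes P: "finite P" and A: "finite A" "A \<subseteq> smooth P \<times> smooth P" and K: "0 < K" and \<delta>: "0 < \<delta>"
    and lower: "\<And>s1 s2. - \<delta> \<le> Re s1 \<Longrightarrow> - \<delta> \<le> Re s2 \<Longrightarrow> K \<le> norm (dpoly A g s1 s2)"
  obtains Z where "\<And>N. dirichlet_alg (smooth P \<times> smooth P) ((1 / K) ^ N * Z) (\<lambda>s1 s2. (1 / dpoly A g s1 s2) ^ N)"
proof -
  let ?S = "smooth P \<times> smooth P"
  have SN: "?S \<subseteq> N2" by (auto simp: smooth_def N2_iff)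
  note S = submonoid2_smooth[of P]
  have A': "A \<subseteq> N2" using A SN by auto
  have nz: "dpoly A g s1 s2 \<noteq> 0" if "- \<delta> \<le> Re s1" "- \<delta> \<le> Re s2" for s1 s2
    using lower[OF that] K by auto
  have nzH: "dpoly A g s1 s2 \<noteq> 0" if "s1 \<in> HH" "s2 \<in> HH" for s1 s2
    using nz[of s1 s2] that \<delta> by (auto simp: HH_def)
  obtain \<theta> :: real where \<theta>: "0 < \<theta>" "\<theta> < 1"
    and inj: "inj_on (\<lambda>k. ln (real (fst k)) + \<theta> * ln (real (snd k))) N2"
    using exists_injective_log_weights .
  define l where "l k = ln (real (fst k)) + \<theta> * ln (real (snd k))" for k
  obtain x C where x: "0 \<le> x"
    and far: "dirichlet_alg ?S C (\<lambda>s1 s2. 1 / dpoly A g (s1 + of_real x) (s2 + of_real (\<theta> * x)))"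
    by (rule dpoly_inverse_far[OF S A A' K _ \<theta>]) (use lower \<delta> in \<open>auto simp: HH_def\<close>)
  \<comment> \<open>On \<open>N2\<close> this equals \<open>exp (- \<delta> * l k)\<close>, the
    decay gained by moving the line to \<open>Re w = - \<delta>\<close>. Over pairs of smooth
    numbers it is summable, and its sum becomes \<open>Z\<close>.\<close>
  define z where "z k = real (fst k) powr (- \<delta>) * real (snd k) powr (- (\<theta> * \<delta>))" for k
  have "(\<lambda>(m, n). real m powr (- \<delta>) * real n powr (- (\<theta> * \<delta>))) summable_on ?S"
    using \<delta> \<theta> by (intro summable_on_product smooth_powr_summable P) auto
  then have zs: "z summable_on ?S" by (simp add: z_def[abs_def] case_prod_unfold)
  have z: "exp (l k * (- \<delta>)) = z k" if "k \<in> N2" for k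
    using that by (simp add: z_def l_def N2_iff powr_def algebra_simps flip: exp_add)
  have "dirichlet_alg ?S ((1 / K) ^ N * infsum z ?S) (\<lambda>s1 s2. (1 / dpoly A g s1 s2) ^ N)" for N
  proof -
    obtain c where c: "\<And>k. k \<in> N2 - ?S \<Longrightarrow> c k = 0" "(\<lambda>k. norm (c k)) summable_on N2"
      "\<And>s1 s2. s1 \<in> HH \<Longrightarrow> s2 \<in> HH \<Longrightarrow> (1 / dpoly A g (s1 + of_real x) (s2 + of_real (\<theta> * x))) ^ N = dser c s1 s2"
      using dirichlet_algE[OF dirichlet_alg_power[OF S far]] by metis
    have decay: "norm (c k) \<le> (1 / K) ^ N * exp (l k * (- \<delta> - x))" if k: "k \<in> N2" for k
      unfolding l_def
    proof (rule dser_coeff_decay[OF inj, where G = "\<lambda>s1 s2. (1 / dpoly A g s1 s2) ^ N"])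
      \<comment> \<open>\<open>0 < \<theta> < 1\<close> keeps the second variable in the half plane
        where the lower bound holds.\<close>
      have line: "- \<delta> \<le> Re (of_real \<theta> * w)" if "- \<delta> \<le> Re w" for w
      proof -
        have "- \<delta> \<le> \<theta> * (- \<delta>)" using \<theta> \<delta> by simp
        also have "\<dots> \<le> \<theta> * Re w" using that \<theta> by (intro mult_left_mono) auto
        finally show ?thesis by simp
      qed
      show "(\<lambda>w. (1 / dpoly A g w (of_real \<theta> * w)) ^ N) holomorphic_on {w. - \<delta> \<le> Re w}"
        using nz line by (intro holomorphic_intros dpoly_line_holomorphic A') auto
      show "norm ((1 / dpoly A g w (of_real \<theta> * w)) ^ N) \<le> (1 / K) ^ N" if "- \<delta> \<le> Re w" for w
        using lower[OF that line[OF that]] K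
        by (simp only: norm_power norm_divide norm_one) (intro power_mono divide_left_mono mult_pos_pos, auto)
    qed (use c x \<delta> k in auto)
    \<comment> \<open>Removes the shift: \<open>b\<close> is the candidate coefficient function of
      the N-th power of \<open>1 / g\<close> itself. The factor \<open>exp (l k * x)\<close> cancels
      the \<open>- x\<close> in the exponent of \<open>decay\<close>.\<close>
    define b where "b k = c k * of_real (exp (l k * x))" for k
    have bz: "norm (b k) \<le> (1 / K) ^ N * z k" if "k \<in> N2" for k
    proof -
      have "norm (b k) \<le> (1 / K) ^ N * exp (l k * (- \<delta> - x)) * exp (l k * x)"
        using decay[OF that] by (simp add: b_def norm_mult)
      also have "\<dots> = (1 / K) ^ N * exp (l k * (- \<delta>))"
        by (simp add: mult.assoc algebra_simps flip: exp_add)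
      finally show ?thesis using z[OF that] by simp
    qed
    have b0: "b k = 0" if "k \<in> N2 - ?S" for k using c(1)[OF that] by (simp add: b_def)
    have zs': "(\<lambda>k. (1 / K) ^ N * z k) summable_on ?S" by (intro summable_on_cmult_right zs)
    have bs: "(\<lambda>k. norm (b k)) summable_on ?S"
      by (rule Infinite_Sum.abs_summable_on_comparison_test'[OF zs']) (use bz SN in auto)
    have "(\<lambda>k. norm (b k)) summable_on ?S \<longleftrightarrow> (\<lambda>k. norm (b k)) summable_on N2"
      by (rule summable_on_cong_neutral) (use SN b0 in auto)
    with bs have bN: "(\<lambda>k. norm (b k)) summable_on N2" by simp
    have "(\<Sum>\<^sub>\<infinity>k\<in>N2. norm (b k)) = (\<Sum>\<^sub>\<infinity>k\<in>?S. norm (b k))"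
      by (rule infsum_cong_neutral) (use SN b0 in auto)
    also have "\<dots> \<le> (\<Sum>\<^sub>\<infinity>k\<in>?S. (1 / K) ^ N * z k)"
      using bz SN by (intro infsum_mono bs zs') auto
    also have "\<dots> = (1 / K) ^ N * infsum z ?S" by (simp add: infsum_cmult_right')
    finally have B: "dirichlet_alg ?S ((1 / K) ^ N * infsum z ?S) (dser b)"
      by (intro dirichlet_algI b0 bN)
    have b_shift: "dser b (s1 + of_real x) (s2 + of_real (\<theta> * x)) = dser c s1 s2" for s1 s2
      unfolding dser_shift
    proof (rule dser_cong)
      fix k assume "k \<in> N2"
      from dmon_line[OF this, of "of_real x" \<theta>]
      have "dmon k (of_real x) (of_real (\<theta> * x)) = of_real (exp (- (l k * x)))"
        by (simp add: l_def algebra_simps flip: exp_of_real)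
      then show "b k * dmon k (of_real x) (of_real (\<theta> * x)) = c k"
        by (simp add: b_def mult.assoc flip: of_real_mult exp_add)
    qed
    have "dirichlet_alg ?S ((1 / K) ^ N * infsum z ?S * (\<Sum>k\<in>A. norm (g k)) ^ N)
       (\<lambda>s1 s2. dser b s1 s2 * dpoly A g s1 s2 ^ N)"
      by (intro dirichlet_alg_mult dirichlet_alg_power S B dirichlet_alg_dpoly A A')
    then obtain e where e: "(\<lambda>k. norm (e k)) summable_on N2"
      "\<And>s1 s2. s1 \<in> HH \<Longrightarrow> s2 \<in> HH \<Longrightarrow> dser b s1 s2 * dpoly A g s1 s2 ^ N = dser e s1 s2"
      by (rule dirichlet_algE) blast
    have HHx: "s1 + of_real x \<in> HH" "s1 + of_real (\<theta> * x) \<in> HH" if "s1 \<in> HH" for s1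
      using that x \<theta> by (auto simp: HH_def)
    \<comment> \<open>\<open>dser b\<close> inverts the power of \<open>g\<close> far to the right; by uniqueness of the coefficients
      \<open>e\<close> of the product, it does so on all of \<open>HH \<times> HH\<close>.\<close>
    have e1: "e k = dunit k" if k: "k \<in> N2" for k
    proof -
      let ?d = "\<lambda>k. dmon k (of_real x) (of_real (\<theta> * x))"
      have "e k * ?d k = dunit k"
      proof (rule dser_eq_1_imp[OF _ _ k])
        show "(\<lambda>k. norm (e k * ?d k)) summable_on N2"
          by (rule abs_summable_dser[OF e(1)]) (use x \<theta> in \<open>auto simp: HH_def\<close>)
        fix s1 s2 assume H: "s1 \<in> HH" "s2 \<in> HH"
        have "dser (\<lambda>k. e k * ?d k) s1 s2 = dser e (s1 + of_real x) (s2 + of_real (\<theta> * x))"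
          by (rule dser_shift[symmetric])
        also have "\<dots> = dser c s1 s2 * dpoly A g (s1 + of_real x) (s2 + of_real (\<theta> * x)) ^ N"
          using e(2)[OF HHx(1)[OF H(1)] HHx(2)[OF H(2)]] by (simp only: b_shift)
        also have "\<dots> = 1"
          using nzH[OF HHx(1)[OF H(1)] HHx(2)[OF H(2)]]
          by (simp only: c(3)[OF H, symmetric]) (simp flip: power_mult_distrib)
        finally show "dser (\<lambda>k. e k * ?d k) s1 s2 = 1" .
      qed
      \<comment> \<open>The shift factor can be cancelled; at \<open>(1, 1)\<close>, the only place
        where \<open>dunit\<close> is nonzero, it equals 1.\<close>
      moreover have "?d k \<noteq> 0" using k by (simp add: dmon_def N2_iff)
      ultimately show ?thesis using dmon_one[of "of_real x" "of_real (\<theta> * x)"]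
        by (cases "k = (1, 1)") (auto simp: dunit_def)
    qed
    show ?thesis
    proof (rule dirichlet_alg_cong[OF B])
      fix s1 s2 assume H: "s1 \<in> HH" "s2 \<in> HH"
      have "dser b s1 s2 * dpoly A g s1 s2 ^ N = dser (\<lambda>k. 1 * dunit k) s1 s2"
        unfolding e(2)[OF H] by (rule dser_cong) (simp add: e1)
      also have "\<dots> = 1" by (rule dser_dunit)
      finally show "dser b s1 s2 = (1 / dpoly A g s1 s2) ^ N"
        using nzH[OF H] by (simp add: field_simps)
    qed
  qed
  with that show thesis by blast
qed

subsection \<open>Equivalence of the three conditions\<close>

text \<open>How the constants fit: the tail \<open>h\<close> has norm at most \<open>k / 4\<close>,
  so \<open>g\<close> is at least \<open>3 * k / 4\<close> on \<open>HH\<close>; widening the half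
  planes costs another \<open>k / 4\<close>, and the expansion in \<open>h / g\<close> has ratio
  \<open>(k / 4) / (k / 2) = 1 / 2\<close>.\<close>

lemma bounded_away_zero_inverse:
  assumes a: "(\<lambda>k. norm (a k)) summable_on N2" and k: "0 < k"
    and lower: "\<And>s1 s2. s1 \<in> HH \<Longrightarrow> s2 \<in> HH \<Longrightarrow> k \<le> norm (dser a s1 s2)"
  obtains C where "dirichlet_alg N2 C (\<lambda>s1 s2. 1 / dser a s1 s2)"
proof -
  obtain J where J: "finite J" "J \<subseteq> N2" "(\<Sum>\<^sub>\<infinity>i\<in>N2 - J. norm (a i)) \<le> k / 4"
    using summable_on_finite_tail[OF a, of "k / 4" "{}"] k by auto
  \<comment> \<open>The tail with reversed sign, so that \<open>dser a\<close> is
    \<open>?g - dser h\<close> and the reciprocal expands without alternating signs.\<close>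
  define h where "h i = (if i \<in> J then 0 else - a i)" for i
  have hs: "(\<lambda>i. norm (h i)) summable_on N2"
    by (rule Infinite_Sum.abs_summable_on_comparison_test'[OF a]) (auto simp: h_def)
  have "(\<Sum>\<^sub>\<infinity>i\<in>N2. norm (h i)) = (\<Sum>\<^sub>\<infinity>i\<in>N2 - J. norm (a i))"
    by (rule infsum_cong_neutral) (auto simp: h_def)
  with J(3) have h: "dirichlet_alg N2 (k / 4) (dser h)"
    by (intro dirichlet_algI hs) auto
  let ?g = "dpoly J a"
  have split: "dser a s1 s2 = ?g s1 s2 - dser h s1 s2" if H: "s1 \<in> HH" "s2 \<in> HH" for s1 s2
  proof -
    have "((\<lambda>i. (if i \<in> J then a i else 0) * dmon i s1 s2) has_sum ?g s1 s2) N2"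
      by (rule has_sum_finite_neutralI[of J]) (use J in \<open>auto simp: dpoly_def\<close>)
    moreover have "((\<lambda>i. h i * dmon i s1 s2) has_sum dser h s1 s2) N2"
      unfolding dser_eq by (rule has_sum_infsum[OF abs_summable_summable[OF abs_summable_dser[OF hs H]]])
    ultimately have "((\<lambda>i. (if i \<in> J then a i else 0) * dmon i s1 s2 + - (h i * dmon i s1 s2)) has_sum
        (?g s1 s2 + - dser h s1 s2)) N2"
      by (intro has_sum_add has_sum_uminusI)
    also have "(\<lambda>i. (if i \<in> J then a i else 0) * dmon i s1 s2 + - (h i * dmon i s1 s2)) = (\<lambda>i. a i * dmon i s1 s2)"
      by (auto simp: h_def)
    finally show ?thesis by (simp add: dser_eq infsumI)
  qed
  have hle: "norm (dser h s1 s2) \<le> k / 4" if "s1 \<in> HH" "s2 \<in> HH" for s1 s2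
    by (rule dirichlet_alg_norm_le[OF h that])
  have gle: "3 * k / 4 \<le> norm (?g s1 s2)" if H: "s1 \<in> HH" "s2 \<in> HH" for s1 s2
    using lower[OF H] hle[OF H] norm_triangle_ineq4[of "?g s1 s2" "dser h s1 s2"] unfolding split[OF H] by simp
  \<comment> \<open>Bounds the change of \<open>?g\<close> when both variables move left by
    \<open>\<delta>\<close> from a point of \<open>HH\<close>. Being a finite sum, it is continuous
    in \<open>\<delta>\<close>, and it vanishes at 0.\<close>
  let ?D = "\<lambda>\<delta>::real. \<Sum>i\<in>J. norm (a i) * norm (dmon i (- of_real \<delta>) (- of_real \<delta>) - 1)"
  have "((\<lambda>\<delta>. ?D \<delta>) \<longlongrightarrow> ?D 0) (at_right 0)"
  proof (intro tendsto_sum tendsto_mult tendsto_norm tendsto_diff tendsto_const)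
    fix i assume "i \<in> J"
    then have "0 < fst i" "0 < snd i" using J by (auto simp: N2_iff)
    then show "((\<lambda>\<delta>. dmon i (- of_real \<delta>) (- of_real \<delta>)) \<longlongrightarrow> dmon i (- of_real 0) (- of_real 0)) (at_right 0)"
      unfolding dmon_def by (intro tendsto_intros) (auto simp: powr_def intro!: tendsto_intros tendsto_eq_intros)
  qed
  moreover have "?D 0 = 0"
    using J by (intro sum.neutral) (auto simp: dmon_def N2_iff)
  ultimately have "\<forall>\<^sub>F \<delta> in at_right 0. ?D \<delta> < k / 4"
    using k by (intro order_tendstoD(2)[of _ "?D 0"]) auto
  moreover have "\<forall>\<^sub>F \<delta> in at_right (0::real). 0 < \<delta>" by (rule eventually_at_right_less)
  ultimately have "\<forall>\<^sub>F \<delta> in at_right 0. ?D \<delta> < k / 4 \<and> 0 < \<delta>" by (rule eventually_conj)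
  then obtain \<delta> where \<delta>: "?D \<delta> < k / 4" "0 < \<delta>"
    using eventually_happens[of _ "at_right (0::real)"] trivial_limit_at_right_real by blast
  have glow: "k / 2 \<le> norm (?g s1 s2)" if s: "- \<delta> \<le> Re s1" "- \<delta> \<le> Re s2" for s1 s2
  proof -
    define t1 where "t1 = s1 + of_real \<delta>"
    define t2 where "t2 = s2 + of_real \<delta>"
    have t: "t1 \<in> HH" "t2 \<in> HH" using s by (auto simp: t1_def t2_def HH_def)
    let ?d = "\<lambda>i. dmon i (- of_real \<delta>) (- of_real \<delta>)"
    have "?g s1 s2 = ?g (t1 + - of_real \<delta>) (t2 + - of_real \<delta>)" by (simp add: t1_def t2_def)
    then have "?g s1 s2 - ?g t1 t2 = (\<Sum>i\<in>J. a i * dmon i t1 t2 * (?d i - 1))"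
      unfolding dpoly_shift by (simp add: dpoly_def algebra_simps flip: sum_subtractf)
    also have "norm \<dots> \<le> ?D \<delta>"
    proof (rule sum_norm_le)
      fix i assume "i \<in> J"
      then have "norm (dmon i t1 t2) \<le> 1" using J t by (intro norm_dmon_le_1) auto
      then have "norm (a i) * norm (dmon i t1 t2) \<le> norm (a i)" by (simp add: mult_left_le)
      then show "norm (a i * dmon i t1 t2 * (?d i - 1)) \<le> norm (a i) * norm (?d i - 1)"
        unfolding norm_mult by (rule mult_right_mono) simp
    qed
    finally have "norm (?g s1 s2 - ?g t1 t2) < k / 4" using \<delta> by simp
    then show ?thesis using gle[OF t] norm_triangle_ineq2[of "?g t1 t2" "?g s1 s2"] k
      by (simp add: norm_minus_commute)
  qed
  define P where "P = (\<Union>i\<in>J. prime_factors (fst i) \<union> prime_factors (snd i))"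
  have P: "finite P" "J \<subseteq> smooth P \<times> smooth P"
    using J by (auto simp: P_def smooth_def N2_iff)
  obtain Z where Z: "\<And>N. dirichlet_alg (smooth P \<times> smooth P) ((1 / (k / 2)) ^ N * Z) (\<lambda>s1 s2. (1 / ?g s1 s2) ^ N)"
    by (rule dpoly_inverse_powers[OF P(1) J(1) P(2) _ \<delta>(2) glow]) (use k in auto)
  have ZN: "dirichlet_alg N2 ((1 / (k / 2)) ^ N * Z) (\<lambda>s1 s2. (1 / ?g s1 s2) ^ N)" for N
    by (rule dirichlet_alg_mono[OF Z]) (auto simp: smooth_def N2_iff)
  let ?f = "\<lambda>N s1 s2. dser h s1 s2 ^ N * (1 / ?g s1 s2) ^ Suc N"
  let ?C = "\<lambda>N. (k / 4) ^ N * ((1 / (k / 2)) ^ Suc N * Z)"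
  have "dirichlet_alg N2 (suminf ?C) (\<lambda>s1 s2. 1 / dser a s1 s2)"
  proof (rule dirichlet_alg_sums)
    show "dirichlet_alg N2 (?C N) (?f N)" for N
      by (intro dirichlet_alg_mult dirichlet_alg_power submonoid2_N2 h ZN)
    have "?C N = (1 / 2) ^ N * (2 * Z / k)" for N
    proof -
      have "?C N = ((k / 4) * (1 / (k / 2))) ^ N * (2 * Z / k)"
        unfolding power_mult_distrib by simp
      also have "(k / 4) * (1 / (k / 2)) = 1 / 2" using k by simp
      finally show ?thesis .
    qed
    then show "summable ?C" by (simp only:) (intro summable_mult2 summable_geometric, simp)
    fix s1 s2 assume H: "s1 \<in> HH" "s2 \<in> HH"
    have g0: "?g s1 s2 \<noteq> 0" using gle[OF H] k by auto
    have "norm (dser h s1 s2) < norm (?g s1 s2)" using gle[OF H] hle[OF H] k by simp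
    then have "norm (dser h s1 s2 / ?g s1 s2) < 1" using g0 by (simp add: norm_divide)
    from sums_mult[OF geometric_sums[OF this], of "1 / ?g s1 s2"]
    have "(\<lambda>N. 1 / ?g s1 s2 * (dser h s1 s2 / ?g s1 s2) ^ N) sums
        (1 / ?g s1 s2 * (1 / (1 - dser h s1 s2 / ?g s1 s2)))" .
    also have "(\<lambda>N. 1 / ?g s1 s2 * (dser h s1 s2 / ?g s1 s2) ^ N) = (\<lambda>N. ?f N s1 s2)"
      by (simp add: power_divide)
    also have "1 / ?g s1 s2 * (1 / (1 - dser h s1 s2 / ?g s1 s2)) = 1 / dser a s1 s2"
    proof -
      have "?g s1 s2 * (1 - dser h s1 s2 / ?g s1 s2) = dser a s1 s2"
        using g0 by (simp add: split[OF H] right_diff_distrib)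
      then show ?thesis by (simp only: times_divide_times_eq mult_1)
    qed
    finally show "(\<lambda>N. ?f N s1 s2) sums (1 / dser a s1 s2)" .
  qed
  with that show thesis .
qed

theorem theoremA:
  fixes a :: "nat \<times> nat \<Rightarrow> complex" and ta :: "complex \<Rightarrow> complex \<Rightarrow> complex"
  assumes "a \<in> l1"
    and "\<forall>s1\<in>HH. \<forall>s2\<in>HH. ta s1 s2 = dser a s1 s2"
  shows "((\<forall>s1\<in>HH. \<forall>s2\<in>HH. ta s1 s2 \<noteq> 0) \<and> has_abs_dirichlet (\<lambda>s1 s2. 1 / ta s1 s2)
            \<longleftrightarrow> l1_invertible a)
       \<and> (l1_invertible a \<longleftrightarrow> bounded_away_zero ta)"
proof -
  have a: "(\<lambda>k. norm (a k)) summable_on N2" using assms(1) by (simp add: l1_def)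
  have ta: "ta s1 s2 = dser a s1 s2" if "s1 \<in> HH" "s2 \<in> HH" for s1 s2
    using assms(2) that by blast
  \<comment> \<open>Since \<open>1 / 0 = 0\<close>, nonvanishing is part of condition (i): for
    \<open>a = 0\<close> the reciprocal would otherwise be the zero series.\<close>
  let ?i = "(\<forall>s1\<in>HH. \<forall>s2\<in>HH. ta s1 s2 \<noteq> 0) \<and> has_abs_dirichlet (\<lambda>s1 s2. 1 / ta s1 s2)"
  have i_ii: "l1_invertible a" if ?i
  proof -
    from that obtain b where "b \<in> l1"
      and b: "\<And>s1 s2. s1 \<in> HH \<Longrightarrow> s2 \<in> HH \<Longrightarrow> 1 / ta s1 s2 = dser b s1 s2"
      unfolding has_abs_dirichlet_def by blast
    then have bs: "(\<lambda>k. norm (b k)) summable_on N2" by (simp add: l1_def)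
    have one: "dser a s1 s2 * dser b s1 s2 = 1" if "s1 \<in> HH" "s2 \<in> HH" for s1 s2
      using b[OF that, symmetric] ta[OF that] \<open>?i\<close> that by auto
    \<comment> \<open>Both convolutions have transform 1, and uniqueness of coefficients turns this
      into equality with the unit.\<close>
    have "dconv a b k = dunit k" "dconv b a k = dunit k" if "k \<in> N2" for k
      using that one
      by (auto intro!: dser_eq_1_imp dconv_summable a bs simp: dser_dconv[OF a bs] dser_dconv[OF bs a] mult.commute)
    with \<open>b \<in> l1\<close> assms(1) show ?thesis unfolding l1_invertible_def by blast
  qed
  have ii_iii: "bounded_away_zero ta" if "l1_invertible a"
  proof -
    from that obtain b where "b \<in> l1" and b: "\<And>k. k \<in> N2 \<Longrightarrow> dconv a b k = dunit k"
      unfolding l1_invertible_def by blast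
    then have bs: "(\<lambda>k. norm (b k)) summable_on N2" by (simp add: l1_def)
    let ?B = "\<Sum>\<^sub>\<infinity>k\<in>N2. norm (b k)"
    have B: "0 \<le> ?B" by (intro infsum_nonneg) auto
    \<comment> \<open>The two transforms multiply to 1, and that of \<open>b\<close> is at most
      \<open>?B\<close>. Adding 1 makes the denominator positive from \<open>0 \<le> ?B\<close>
      alone.\<close>
    have "1 / (?B + 1) \<le> norm (ta s1 s2)" if H: "s1 \<in> HH" "s2 \<in> HH" for s1 s2
    proof -
      have "dser a s1 s2 * dser b s1 s2 = dser (\<lambda>k. 1 * dunit k) s1 s2"
        unfolding dser_dconv[OF a bs H, symmetric] by (rule dser_cong) (simp add: b)
      then have "1 = norm (ta s1 s2) * norm (dser b s1 s2)"
        unfolding dser_dunit ta[OF H] by (simp flip: norm_mult)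
      also have "\<dots> \<le> norm (ta s1 s2) * (?B + 1)"
        using norm_dser_le[OF bs H] by (intro mult_left_mono) auto
      finally show ?thesis using B by (simp add: divide_le_eq)
    qed
    moreover have "0 < 1 / (?B + 1)" using B by simp
    ultimately show ?thesis unfolding bounded_away_zero_def by blast
  qed
  have iii_i: ?i if "bounded_away_zero ta"
  proof -
    from that obtain k where k: "0 < k" and low: "\<And>s1 s2. s1 \<in> HH \<Longrightarrow> s2 \<in> HH \<Longrightarrow> k \<le> norm (dser a s1 s2)"
      unfolding bounded_away_zero_def using ta by metis
    obtain C where "dirichlet_alg N2 C (\<lambda>s1 s2. 1 / dser a s1 s2)"
      using bounded_away_zero_inverse[OF a k low] .
    then have "has_abs_dirichlet (\<lambda>s1 s2. 1 / ta s1 s2)"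
      unfolding dirichlet_alg_def has_abs_dirichlet_def l1_def using ta by auto
    moreover have "ta s1 s2 \<noteq> 0" if "s1 \<in> HH" "s2 \<in> HH" for s1 s2
      using low[OF that] ta[OF that] k by auto
    ultimately show ?thesis by blast
  qed
  from i_ii ii_iii iii_i show ?thesis by blast
qed

end
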